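(* Let $\beta\in\mathbb{R}$ and let $p$ be analytic on $\mathbb{D}$ with $p(0)=1$ and $$1+\beta\frac{zp'(z)}{p(z)}\prec\varphi_{Ne}(z)=1+z-\frac{z^3}{3}.$$ Then the following subordinations hold: (a) $p(z)\prec1+\sin z$ whenever $\beta\geq\frac{8/9}{\log(1+\sin1)}\approx1.45585$. (b) $p(z)\prec1+\frac{z}{k}\left(\frac{k+z}{k-z}\right)$, where $k=1+\sqrt{2}$, whenever $\beta\geq-\frac{8/9}{\log(2\sqrt{2}-2)}\approx4.72245$. (c) $p(z)\prec\varphi_{Ne}(z)$ whenever $\beta\geq\frac{8/9}{\log(5/3)}$. The bounds on $\beta$ are best possible, i.e. in each part the lower bound on $\beta$ cannot be replaced by a smaller number.
   Context: $\mathbb{D}$ is the open unit disk. For analytic $f,g$ on $\mathbb{D}$, $f\prec g$ means there is an analytic $w$ on $\mathbb{D}$ with $w(0)=0$, $|w(z)|<1$ and $f(z)=g(w(z))$ on $\mathbb{D}$; in particular the left-hand side of the hypothesis is understood to be analytic on $\mathbb{D}$. *)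

theory Defs
  imports "HOL-Complex_Analysis.Complex_Analysis"
begin

definition subordinate :: "(complex \<Rightarrow> complex) \<Rightarrow> (complex \<Rightarrow> complex) \<Rightarrow> bool"
    (infix "\<prec>\<^sub>D" 50) where
  "f \<prec>\<^sub>D g \<longleftrightarrow>
     f holomorphic_on ball 0 1 \<and> g holomorphic_on ball 0 1 \<and>
     (\<exists>w. w holomorphic_on ball 0 1 \<and> w 0 = 0 \<and>
          (\<forall>z\<in>ball 0 1. norm (w z) < 1) \<and>
          (\<forall>z\<in>ball 0 1. f z = g (w z)))"

definition \<phi>_Ne :: "complex \<Rightarrow> complex" where
  "\<phi>_Ne z = 1 + z - z ^ 3 / 3"

definition \<phi>_sin :: "complex \<Rightarrow> complex" where
  "\<phi>_sin z = 1 + sin z"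

definition \<phi>_rat :: "complex \<Rightarrow> complex" where
  "\<phi>_rat z = (let k = complex_of_real (1 + sqrt 2) in 1 + z / k * ((k + z) / (k - z)))"

(* Analyticity of 1 + \<beta> z p'(z) / p(z) is part of the subordination. Division is total, with
   x / 0 = 0, but this does no harm: for \<beta> \<noteq> 0 the expression has a genuine pole at every zero
   of p in the disk, hence is not holomorphic there, so p has no zeros. *)
definition nephroid_hyp :: "real \<Rightarrow> (complex \<Rightarrow> complex) \<Rightarrow> bool" where
  "nephroid_hyp \<beta> p \<longleftrightarrow>
     p holomorphic_on ball 0 1 \<and> p 0 = 1 \<and>
     (\<lambda>z. 1 + complex_of_real \<beta> * (z * deriv p z / p z)) \<prec>\<^sub>D \<phi>_Ne"

end

theory Submission
  imports Defs
begin

text \<open>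
  Write p = exp P and F = \<beta> P, so that z F'(z) = G(w(z)) with G(w) = w - w^3/3 and, by the Schwarz
  lemma, |w(z)| \<le> |z|.  It suffices to control F by a disc and a vertical strip, |F| < 10/9 and
  |Re F| < 8/9.  For the strip, maximise Re F(z) - (1 + e) (|z| - |z|^3/9) on a closed disc:
  at a maximum point z \<noteq> 0 the number z F'(z) is real, which forces w(z) to be real, and then the
  radial derivative is negative, a contradiction.

  A connectedness argument turns the claim p \<prec> \<phi>, for univalent \<phi>, into p(z) \<noteq> \<phi>(\<zeta>) for
  |\<zeta>| = 1, that is, no logarithm of \<phi>(\<zeta>) lies in the truncated disc allowed for
  P = F/\<beta>.  The critical \<beta> is the one for which the edge of the strip passes through
  log \<phi>(\<zeta>) at \<zeta> = 1 (or -1).  Sharpness follows from p(z) = exp((z - z^3/9)/\<beta>),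
  because \<phi> takes real values on the disc only at real points.
\<close>

section \<open>Bounds for solutions of the nephroid equation\<close>

text \<open>A maximum principle for \<open>Re (f x) - (1 + e) * h (norm x)\<close> on a closed disc:
  a maximum point away from 0 is impossible. The rotation derivative vanishes there, so
  \<open>bound\<close> is assumed only where \<open>z * deriv f z\<close> is real. The factor
  \<open>1 + e\<close> makes the radial comparison strict, and \<open>e\<close> finally tends to
  0.\<close>

lemma radial_majorant:
  fixes f :: "complex \<Rightarrow> complex" and h h' :: "real \<Rightarrow> real"
  assumes holf: "f holomorphic_on ball 0 1" and f0: "f 0 = 0" and h0: "h 0 = 0"
    and dh: "\<And>r. 0 \<le> r \<Longrightarrow> r < 1 \<Longrightarrow> (h has_real_derivative h' r) (at r)"
    and h'_pos: "\<And>r. 0 \<le> r \<Longrightarrow> r < 1 \<Longrightarrow> h' r > 0"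
    and bound: "\<And>z. z \<in> ball 0 1 \<Longrightarrow> z \<noteq> 0 \<Longrightarrow> Im (z * deriv f z) = 0 \<Longrightarrow> Re (z * deriv f z) \<le> norm z * h' (norm z)"
    and z: "z \<in> ball 0 1"
  shows "Re (f z) \<le> h (norm z)"
proof -
  define R where "R = norm z"
  have R: "0 \<le> R" "R < 1" using z by (auto simp: R_def)
  have df: "(f has_field_derivative deriv f x) (at x)" if "x \<in> ball 0 1" for x
    using holomorphic_derivI[OF holf open_ball that] .
  have main: "Re (f z) \<le> (1 + e) * h R" if e: "e > 0" for e
  proof -
    define g where "g x = Re (f x) - (1 + e) * h (norm x)" for x
    have "isCont h r" if "0 \<le> r" "r < 1" for r
      using DERIV_isCont[OF dh[OF that]] .
    then have "continuous_on {0..R} h"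
      using R by (auto intro!: continuous_at_imp_continuous_on)
    then have "continuous_on (cball 0 R) (\<lambda>x::complex. h (norm x))"
      by (intro continuous_on_compose2[where f = norm and g = h]) (auto intro!: continuous_intros)
    moreover have "continuous_on (cball 0 R) f"
      using holf R by (intro continuous_on_subset[OF holomorphic_on_imp_continuous_on]) auto
    ultimately have "continuous_on (cball 0 R) g"
      unfolding g_def by (intro continuous_intros)
    then obtain x where x: "x \<in> cball 0 R" and max: "\<And>y. y \<in> cball 0 R \<Longrightarrow> g y \<le> g x"
      using continuous_attains_sup[of "cball 0 R" g] R by (metis cball_eq_empty compact_cball not_less)
    have xb: "x \<in> ball 0 1" using x R by auto
    have "x = 0"
    proof (rule ccontr)
      assume "x \<noteq> 0"
      \<comment> \<open>Along the circle through \<open>x\<close> the norm is constant, so the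
        majorant contributes nothing to the derivative.\<close>
      have rot: "((\<lambda>t. g (x * exp (\<i> * of_real t))) has_real_derivative - Im (x * deriv f x)) (at 0)"
      proof -
        have fx: "(f has_field_derivative deriv f x) (at (x * exp (\<i> * of_real 0)))"
          using df[OF xb] by simp
        have "((\<lambda>t::real. x * exp (\<i> * of_real t)) has_vector_derivative x * \<i>) (at 0)"
          by (rule has_vector_derivative_real_field) (auto intro!: derivative_eq_intros)
        from field_vector_diff_chain_at[OF this fx]
        have "((\<lambda>t::real. f (x * exp (\<i> * of_real t))) has_vector_derivative x * \<i> * deriv f x) (at 0)"
          by (simp add: o_def mult.commute)
        then have "((\<lambda>t::real. Re (f (x * exp (\<i> * of_real t)))) has_real_derivative Re (x * \<i> * deriv f x)) (at 0)"
          by (rule has_field_derivative_Re)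
        then have "((\<lambda>t. g (x * exp (\<i> * of_real t))) has_real_derivative Re (x * \<i> * deriv f x) - 0) (at 0)"
          unfolding g_def norm_mult by (intro DERIV_diff) (auto simp: norm_exp_i_times)
        then show ?thesis by (simp add: algebra_simps)
      qed
      have "- Im (x * deriv f x) = 0"
        by (rule DERIV_local_max[OF rot zero_less_one]) (use x in \<open>auto intro!: max simp: norm_mult\<close>)
      then have im0: "Im (x * deriv f x) = 0" by simp
      define D where "D = Re (x * deriv f x) - (1 + e) * (h' (norm x) * norm x)"
      have scale: "((\<lambda>t. g (of_real t * x)) has_real_derivative D) (at 1)"
      proof -
        have fx: "(f has_field_derivative deriv f x) (at (of_real 1 * x))"
          using df[OF xb] by simp
        have "((\<lambda>t::real. of_real t * x) has_vector_derivative x) (at 1)"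
          by (auto intro!: derivative_eq_intros)
        from field_vector_diff_chain_at[OF this fx]
        have "((\<lambda>t::real. f (of_real t * x)) has_vector_derivative x * deriv f x) (at 1)"
          by (simp add: o_def)
        then have 1: "((\<lambda>t::real. Re (f (of_real t * x))) has_real_derivative Re (x * deriv f x)) (at 1)"
          by (rule has_field_derivative_Re)
        have "(h has_real_derivative h' (norm x)) (at (1 * norm x))" using dh[of "norm x"] xb by simp
        moreover have "((\<lambda>t. t * norm x) has_real_derivative norm x) (at 1)"
          by (auto intro!: derivative_eq_intros)
        ultimately have "((\<lambda>t. h (t * norm x)) has_real_derivative h' (norm x) * norm x) (at 1)"
          by (rule DERIV_chain2)
        then have "((\<lambda>t. Re (f (of_real t * x)) - (1 + e) * h (t * norm x)) has_real_derivative
            Re (x * deriv f x) - (1 + e) * (h' (norm x) * norm x)) (at 1)"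
          by (intro DERIV_diff DERIV_cmult 1)
        then have "((\<lambda>t. g (of_real t * x)) has_real_derivative
            Re (x * deriv f x) - (1 + e) * (h' (norm x) * norm x)) (at 1)"
          by (rule has_field_derivative_transform_within[of _ _ _ _ 1])
            (auto simp: g_def norm_mult dist_real_def)
        then show ?thesis unfolding D_def .
      qed
      have "Re (x * deriv f x) \<le> norm x * h' (norm x)"
        using bound xb \<open>x \<noteq> 0\<close> im0 by blast
      also have "\<dots> < norm x * ((1 + e) * h' (norm x))"
        using \<open>x \<noteq> 0\<close> e h'_pos[of "norm x"] xb by simp
      finally have "D < 0" using \<open>x \<noteq> 0\<close> by (simp add: D_def algebra_simps)
      \<comment> \<open>\<open>x\<close> may lie on the bounding circle, so only inward moves are
        admissible; a negative radial derivative makes \<open>g\<close> larger just inside.\<close>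
      from DERIV_neg_dec_left[OF scale this] obtain d where d: "d > 0" "\<And>h. 0 < h \<Longrightarrow> h < d \<Longrightarrow> g x < g (of_real (1 - h) * x)"
        by auto
      define s where "s = min (d / 2) 1"
      have "g x < g (of_real (1 - s) * x)" using d by (auto simp: s_def)
      moreover have "norm (of_real (1 - s) * x) \<le> 1 * norm x"
        unfolding norm_mult norm_of_real using d by (intro mult_right_mono) (auto simp: s_def)
      then have "g (of_real (1 - s) * x) \<le> g x"
        using x by (intro max) simp
      ultimately show False by simp
    qed
    have "g z \<le> g x" using max by (simp add: R_def)
    then show ?thesis using \<open>x = 0\<close> f0 h0 by (simp add: g_def R_def)
  qed
  have "((\<lambda>e. (1 + e) * h R) \<longlongrightarrow> (1 + 0) * h R) (at_right 0)"
    by (intro tendsto_intros)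
  then have "Re (f z) \<le> (1 + 0) * h R"
    by (rule tendsto_lowerbound) (auto simp: eventually_at_right_less main intro: eventually_mono[OF eventually_at_right_less])
  then show ?thesis by (simp add: R_def)
qed

text \<open>The imaginary part has the factor \<open>Im w\<close>; the cofactor
  \<open>1 - (Re w)^2 + (Im w)^2 / 3\<close> is positive in the disc.\<close>

lemma nephroid_real_value:
  assumes w: "norm w < 1" and im: "Im (w - w ^ 3 / 3) = 0"
  shows "Im w = 0"
proof (rule ccontr)
  assume nz: "Im w \<noteq> 0"
  have "Im (w - w ^ 3 / 3) = Im w * (1 - (Re w)\<^sup>2 + (Im w)\<^sup>2 / 3)"
    by (simp add: power2_eq_square power3_eq_cube field_simps)
  then have "1 - (Re w)\<^sup>2 + (Im w)\<^sup>2 / 3 = 0" using im nz by simp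
  moreover have "(Re w)\<^sup>2 + (Im w)\<^sup>2 < 1" using w unfolding cmod_power2[symmetric] by (simp add: power_less_one_iff)
  ultimately show False using nz zero_less_power2[of "Im w"] by linarith
qed

text \<open>The majorants \<open>r - r^3 / 9\<close> and \<open>r + r^3 / 9\<close> are the
  integrals of \<open>(r - r^3 / 3) / r\<close> and \<open>(r + r^3 / 3) / r\<close>, with values
  8/9 and 10/9 at r = 1. The strip relies on \<open>w\<close> being real at the critical points, the
  disc only on the triangle inequality.\<close>

lemma nephroid_ode_bounds:
  assumes holF: "F holomorphic_on ball 0 1" and F0: "F 0 = 0"
    and w: "\<And>z. z \<in> ball 0 1 \<Longrightarrow> norm (w z) \<le> norm z"
    and ode: "\<And>z. z \<in> ball 0 1 \<Longrightarrow> z * deriv F z = w z - w z ^ 3 / 3"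
    and z: "z \<in> ball 0 1"
  shows "\<bar>Re (F z)\<bar> < 8 / 9" and "norm (F z) < 10 / 9"
proof -
  have deriv_scale: "x * deriv (\<lambda>x. c * F x) x = c * (w x - w x ^ 3 / 3)" if "x \<in> ball 0 1" for x c
  proof -
    have "deriv (\<lambda>x. c * F x) x = c * deriv F x"
      using that holF by (intro deriv_cmult) (auto simp: holomorphic_on_open field_differentiable_def)
    then have "x * deriv (\<lambda>x. c * F x) x = c * (x * deriv F x)" by simp
    then show ?thesis by (simp only: ode[OF that])
  qed
  have mono: "a - a ^ 3 / 3 \<le> b - b ^ 3 / 3" if "- 1 \<le> a" "a \<le> b" "b \<le> 1" for a b :: real
  proof -
    have "(b - a) * (3 - (a\<^sup>2 + a * b + b\<^sup>2)) \<ge> 0"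
    proof (intro mult_nonneg_nonneg)
      have "a\<^sup>2 \<le> 1" "b\<^sup>2 \<le> 1" using that by (simp_all add: abs_square_le_1 abs_le_iff)
      moreover have "2 * (a * b) \<le> a\<^sup>2 + b\<^sup>2" using sum_squares_bound[of a b] by simp
      ultimately show "0 \<le> 3 - (a\<^sup>2 + a * b + b\<^sup>2)" by linarith
    qed (use that in simp)
    also have "(b - a) * (3 - (a\<^sup>2 + a * b + b\<^sup>2)) = 3 * ((b - b ^ 3 / 3) - (a - a ^ 3 / 3))"
      by (simp add: field_simps power2_eq_square power3_eq_cube)
    finally show ?thesis by simp
  qed
  \<comment> \<open>The two signs give the upper and the lower bound; since
    \<open>w - w^3 / 3\<close> is odd, \<open>c * w x\<close> takes the place of
    \<open>w x\<close>.\<close>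
  have re: "Re (c * F z) < 8 / 9" if c: "c \<in> {1, - 1}" for c
  proof -
    have "Re (c * F z) \<le> norm z - norm z ^ 3 / 9"
    proof (rule radial_majorant[where f = "\<lambda>z. c * F z" and h = "\<lambda>r. r - r ^ 3 / 9" and h' = "\<lambda>r. 1 - r\<^sup>2 / 3", OF _ _ _ _ _ _ z])
      fix x :: complex assume x: "x \<in> ball 0 1" "x \<noteq> 0" and im: "Im (x * deriv (\<lambda>z. c * F z) x) = 0"
      define y where "y = c * w x"
      have eq: "x * deriv (\<lambda>z. c * F z) x = y - y ^ 3 / 3"
        using deriv_scale[OF x(1)] c by (auto simp: y_def power3_eq_cube)
      have "norm y \<le> norm x" using w[OF x(1)] c by (auto simp: y_def norm_mult)
      moreover from this have "Im y = 0"
        using nephroid_real_value[of y] im x unfolding eq by simp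
      then obtain r where r: "y = of_real r" by (metis complex_is_Real_iff Reals_cases)
      ultimately have "\<bar>r\<bar> \<le> norm x" by simp
      then have "r - r ^ 3 / 3 \<le> norm x - norm x ^ 3 / 3" using x by (intro mono) auto
      then show "Re (x * deriv (\<lambda>z. c * F z) x) \<le> norm x * (1 - (norm x)\<^sup>2 / 3)"
        unfolding eq r by (simp add: power2_eq_square power3_eq_cube algebra_simps flip: of_real_power)
    next
      fix r :: real assume "0 \<le> r" "r < 1"
      then have "r\<^sup>2 \<le> 1" by (simp add: power_le_one)
      then show "0 < 1 - r\<^sup>2 / 3" by simp
    qed (use F0 holF in \<open>auto intro!: derivative_eq_intros holomorphic_intros simp: power2_eq_square\<close>)
    also have "\<dots> < 8 / 9"
    proof -
      \<comment> \<open>The product is nine times the gap between 8/9 and the majorant.\<close>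
      have "(1 - norm z) * (8 - norm z - (norm z)\<^sup>2) > 0"
        using z power_le_one[of "norm z" 2] by (intro mult_pos_pos) auto
      then show ?thesis by (simp add: power2_eq_square power3_eq_cube algebra_simps)
    qed
    finally show ?thesis .
  qed
  from re[of 1] re[of "- 1"] show "\<bar>Re (F z)\<bar> < 8 / 9" by simp
  have "norm (F z) \<le> norm z + norm z ^ 3 / 9"
  proof -
    \<comment> \<open>Rotating by the conjugate phase of \<open>F\<close> at the fixed point
      \<open>z\<close> turns \<open>norm (F z)\<close> into a real part.\<close>
    define c where "c = cnj (sgn (F z))"
    have nc: "norm c \<le> 1" by (simp add: c_def norm_sgn)
    have "Re (c * F z) \<le> norm z + norm z ^ 3 / 9"
    proof (rule radial_majorant[where f = "\<lambda>z. c * F z" and h = "\<lambda>r. r + r ^ 3 / 9" and h' = "\<lambda>r. 1 + r\<^sup>2 / 3", OF _ _ _ _ _ _ z])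
      fix x :: complex assume x: "x \<in> ball 0 1"
      have "Re (x * deriv (\<lambda>z. c * F z) x) \<le> norm (c * (w x - w x ^ 3 / 3))"
        unfolding deriv_scale[OF x] by (rule complex_Re_le_cmod)
      also have "\<dots> \<le> 1 * (norm (w x) + norm (w x) ^ 3 / 3)"
        unfolding norm_mult using nc
        by (intro mult_mono order_trans[OF norm_triangle_ineq4]) (auto simp: norm_divide norm_power)
      also have "\<dots> \<le> norm x + norm x ^ 3 / 3"
        using w[OF x] by (auto intro!: add_mono power_mono divide_right_mono)
      finally show "Re (x * deriv (\<lambda>z. c * F z) x) \<le> norm x * (1 + (norm x)\<^sup>2 / 3)"
        by (simp add: power2_eq_square power3_eq_cube algebra_simps)
    qed (use F0 holF in \<open>auto intro!: derivative_eq_intros holomorphic_intros simp: power2_eq_square add_pos_nonneg\<close>)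
    moreover have "c * F z = of_real (norm (F z))"
      by (cases "F z = 0") (simp_all add: c_def sgn_eq mult.commute complex_norm_square[symmetric] power2_eq_square)
    ultimately show ?thesis by simp
  qed
  also have "\<dots> < 10 / 9"
    using z power_le_one[of "norm z" 3] by simp
  finally show "norm (F z) < 10 / 9" .
qed

section \<open>Real estimates for sine, cosine and cosh\<close>

lemma nonneg_by_derivative:
  fixes f f' :: "real \<Rightarrow> real"
  assumes "\<And>t. (f has_real_derivative f' t) (at t)" "\<And>t. t \<ge> 0 \<Longrightarrow> f' t \<ge> 0" "f 0 = 0" "x \<ge> 0"
  shows "f x \<ge> 0"
proof -
  have "f 0 \<le> f x"
    by (rule DERIV_nonneg_imp_nondecreasing[OF \<open>x \<ge> 0\<close>]) (use assms in blast)
  then show ?thesis using assms by simp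
qed

lemma cos_ge_taylor2: "cos x \<ge> 1 - x\<^sup>2 / 2" for x :: real
proof -
  have "cos x = 1 - 2 * (sin (x / 2))\<^sup>2"
    using cos_double_sin[of "x / 2"] by simp
  moreover have "(sin (x / 2))\<^sup>2 \<le> (x / 2)\<^sup>2"
    using abs_sin_x_le_abs_x[of "x / 2"] abs_le_square_iff by blast
  ultimately show ?thesis by (simp add: power2_eq_square)
qed

lemma sin_ge_taylor3:
  fixes x :: real assumes "x \<ge> 0" shows "sin x \<ge> x - x ^ 3 / 6"
proof -
  have "sin x - (x - x ^ 3 / 6) \<ge> 0"
    by (rule nonneg_by_derivative[where f' = "\<lambda>t. cos t - (1 - t\<^sup>2 / 2)", OF _ _ _ assms])
      (auto intro!: derivative_eq_intros simp: cos_ge_taylor2)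
  then show ?thesis by simp
qed

lemma cos_le_taylor4:
  fixes x :: real assumes "x \<ge> 0" shows "cos x \<le> 1 - x\<^sup>2 / 2 + x ^ 4 / 24"
proof -
  have "(1 - x\<^sup>2 / 2 + x ^ 4 / 24) - cos x \<ge> 0"
    by (rule nonneg_by_derivative[where f' = "\<lambda>t. sin t - (t - t ^ 3 / 6)", OF _ _ _ assms])
      (auto intro!: derivative_eq_intros simp: sin_ge_taylor3)
  then show ?thesis by simp
qed

lemma sin_le_taylor5:
  fixes x :: real assumes "x \<ge> 0" shows "sin x \<le> x - x ^ 3 / 6 + x ^ 5 / 120"
proof -
  have "(x - x ^ 3 / 6 + x ^ 5 / 120) - sin x \<ge> 0"
    by (rule nonneg_by_derivative[where f' = "\<lambda>t. (1 - t\<^sup>2 / 2 + t ^ 4 / 24) - cos t", OF _ _ _ assms])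
      (auto intro!: derivative_eq_intros simp: cos_le_taylor4)
  then show ?thesis by simp
qed

lemma cosh_ge_taylor4: "cosh x \<ge> 1 + x\<^sup>2 / 2 + x ^ 4 / 24" for x :: real
proof -
  have sinh1: "sinh t - t \<ge> 0" if "t \<ge> 0" for t :: real
    by (rule nonneg_by_derivative[where f' = "\<lambda>t. cosh t - 1", OF _ _ _ that])
      (auto intro!: derivative_eq_intros simp: cosh_real_ge_1)
  have cosh2: "cosh t - (1 + t\<^sup>2 / 2) \<ge> 0" if "t \<ge> 0" for t :: real
    by (rule nonneg_by_derivative[where f' = "\<lambda>t. sinh t - t", OF _ _ _ that])
      (use sinh1 in \<open>auto intro!: derivative_eq_intros\<close>)
  have sinh3: "sinh t - (t + t ^ 3 / 6) \<ge> 0" if "t \<ge> 0" for t :: real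
    by (rule nonneg_by_derivative[where f' = "\<lambda>t. cosh t - (1 + t\<^sup>2 / 2)", OF _ _ _ that])
      (use cosh2 in \<open>auto intro!: derivative_eq_intros\<close>)
  have "cosh t - (1 + t\<^sup>2 / 2 + t ^ 4 / 24) \<ge> 0" if "t \<ge> 0" for t :: real
    by (rule nonneg_by_derivative[where f' = "\<lambda>t. sinh t - (t + t ^ 3 / 6)", OF _ _ _ that])
      (use sinh3 in \<open>auto intro!: derivative_eq_intros\<close>)
  from this[of "\<bar>x\<bar>"] show ?thesis by simp
qed

text \<open>A Pade approximant at 1: the two derivatives differ by a square over a positive
  quantity. It turns lower bounds for \<open>ln\<close> into rational ones that numerals can
  decide.\<close>

lemma ln_ge_ratio:
  fixes y :: real assumes "y \<ge> 1" shows "ln y \<ge> 2 * (y - 1) / (y + 1)"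
proof -
  have "ln (1 + t) - 2 * t / (t + 2) \<ge> 0" if "t \<ge> 0" for t :: real
  proof -
    have "ln (1 + 0) - 2 * 0 / (0 + 2) \<le> ln (1 + t) - 2 * t / (t + 2)"
    proof (rule DERIV_nonneg_imp_nondecreasing[OF that])
      fix s :: real assume s: "0 \<le> s" "s \<le> t"
      have "((\<lambda>t. ln (1 + t) - 2 * t / (t + 2)) has_real_derivative 1 / (1 + s) - 4 / (s + 2)\<^sup>2) (at s)"
        using s by (auto intro!: derivative_eq_intros simp: field_simps power2_eq_square)
      moreover have "1 / (1 + s) - 4 / (s + 2)\<^sup>2 = s\<^sup>2 / ((1 + s) * (s + 2)\<^sup>2)"
        using s by (simp add: divide_simps) (simp add: power2_eq_square algebra_simps)
      ultimately show "\<exists>y. ((\<lambda>t. ln (1 + t) - 2 * t / (t + 2)) has_real_derivative y) (at s) \<and> 0 \<le> y"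
        using s by (intro exI[of _ "1 / (1 + s) - 4 / (s + 2)\<^sup>2"]) auto
    qed
    then show ?thesis by simp
  qed
  from this[of "y - 1"] assms show ?thesis by (simp add: add.commute)
qed

section \<open>Numerical bounds on the unit circle for the target 1 + sin z\<close>

lemma sin1_upper: "sin (1::real) \<le> 0.841667"
  using sin_le_taylor5[of 1] by simp

lemma ln_1_plus_sin1_upper: "ln (1 + sin (1::real)) \<le> 0.612"
proof -
  \<comment> \<open>0.0765 is 0.612 / 8; taking an eighth power makes the quadratic Taylor bound of
    \<open>exp\<close> sharp enough.\<close>
  have "1 + sin (1::real) \<le> (1 + 0.0765 + 0.0765\<^sup>2 / 2) ^ 8"
    using sin1_upper by (simp add: power2_eq_square eval_nat_numeral)
  also have "\<dots> \<le> exp 0.0765 ^ 8"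
    by (rule power_mono[OF exp_lower_Taylor_quadratic]) auto
  also have "\<dots> = exp (0.612::real)"
    by (simp flip: exp_of_nat_mult)
  finally have "ln (1 + sin (1::real)) \<le> ln (exp 0.612)"
    using sin_gt_zero_02[of 1] by (subst ln_le_cancel_iff) auto
  then show ?thesis by simp
qed

text \<open>On this right-hand arc the modulus of 1 + sin is at least its value at 1, so the strip
  alone excludes it. Both \<open>sin 1 - sin u\<close> and \<open>cosh v - 1\<close> are compared
  through Taylor polynomials.\<close>

lemma sin_plus_cosh_ge:
  fixes u v :: real
  assumes uv: "u\<^sup>2 + v\<^sup>2 = 1" and u: "u \<ge> 0.43"
  shows "sin u + cosh v \<ge> 1 + sin 1"
proof -
  have "u \<le> 1"
    using uv by (metis abs_le_square_iff abs_of_nonneg le_add_same_cancel1 one_power2 abs_one zero_le_power2 abs_ge_self order_trans)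
  \<comment> \<open>With the midpoint \<open>m\<close> the bound for \<open>sin 1 - sin u\<close>
    and v^2 = 4 m (1 - m) share the factor 1 - m, leaving a polynomial inequality in
    \<open>m\<close>.\<close>
  define m where "m = (1 + u) / 2"
  have m: "0.715 \<le> m" "m \<le> 1" using u \<open>u \<le> 1\<close> by (auto simp: m_def)
  have "sin 1 - sin u = 2 * cos m * sin (1 - m)"
    using sin_diff_sin[of 1 u] by (simp add: m_def field_simps)
  also have "\<dots> \<le> 2 * cos m * (1 - m)"
    using m sin_x_le_x[of "1 - m"] pi_gt3 by (intro mult_left_mono) (auto intro!: cos_ge_zero)
  also have "\<dots> \<le> 2 * (1 - m\<^sup>2 / 2 + m ^ 4 / 24) * (1 - m)"
    using m cos_le_taylor4[of m] by (intro mult_right_mono mult_left_mono) auto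
  also have "\<dots> \<le> 2 * (m + (1 - m) * m\<^sup>2 / 3) * (1 - m)"
  proof -
    \<comment> \<open>143/200 = 0.715 is the least \<open>m\<close>. The remaining inequality is a
      linear combination of the three nonnegative products below.\<close>
    have m': "143 / 200 \<le> m" using m by simp
    have "(1 - m) * m ^ 3 \<ge> 0" "(m - 143 / 200) * (1 - m) * m \<ge> 0" "(m - 143 / 200)\<^sup>2 \<ge> 0"
      using m m' by auto
    moreover have "(1 - m) * m ^ 3 = m ^ 3 - m ^ 4"
      "(m - 143 / 200) * (1 - m) * m = 343 / 200 * m\<^sup>2 - 143 / 200 * m - m ^ 3"
      "(m - 143 / 200)\<^sup>2 = m\<^sup>2 - 143 / 100 * m + 20449 / 40000"
      "(1 - m) * m\<^sup>2 = m\<^sup>2 - m ^ 3"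
      by (simp_all add: field_simps power2_eq_square eval_nat_numeral)
    ultimately have "1 - m\<^sup>2 / 2 + m ^ 4 / 24 \<le> m + (1 - m) * m\<^sup>2 / 3"
      using m m' by linarith
    then show ?thesis using m by (intro mult_right_mono) auto
  qed
  also have "\<dots> = v\<^sup>2 / 2 + (v\<^sup>2)\<^sup>2 / 24"
  proof -
    have "4 * m * (1 - m) = 1 - u\<^sup>2" by (simp add: m_def power2_eq_square field_simps)
    then have v2: "v\<^sup>2 = 4 * m * (1 - m)" using uv by simp
    show ?thesis unfolding v2 by (simp add: power2_eq_square field_simps)
  qed
  finally show ?thesis using cosh_ge_taylor4[of v] by (simp flip: power_mult)
qed

text \<open>\<open>S\<close> and \<open>C\<close> stand for \<open>sin u\<close> and
  \<open>cosh v\<close>. The logarithm grows with both, and the quotient falls with \<open>S\<close>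
  and grows with \<open>C\<close>, so the bounds \<open>s\<close>, \<open>d\<close>,
  \<open>c\<close> may replace them, each on its worse side.\<close>

lemma sin_cosh_piece:
  fixes S C d c s :: real
  assumes "0 \<le> S" "S \<le> d" "d < 1" "s \<le> S" "c \<le> C" "1 \<le> c"
    and "0 \<le> s" "0.5853 \<le> (2 * (s + c - 1) / (s + c + 1))\<^sup>2 + 2 * ((1 - d) * ((c - 1) / (d + c)))"
  shows "0.5853 \<le> (ln (S + C))\<^sup>2 + 2 * ((1 - S) * ((C - 1) / (S + C)))"
proof -
  have "(c - 1) / (d + c) \<le> (C - 1) / (S + C)"
  proof -
    have "(c - 1) / (d + c) \<le> (c - 1) / (S + c)"
      using assms by (intro divide_left_mono) auto
    also have "\<dots> \<le> (C - 1) / (S + C)"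
    proof -
      have "(C - 1) * (S + c) - (c - 1) * (S + C) = (1 + S) * (C - c)" by algebra
      also have "\<dots> \<ge> 0" using assms by simp
      finally show ?thesis using assms by (simp add: frac_le_eq divide_simps)
    qed
    finally show ?thesis .
  qed
  then have "(1 - d) * ((c - 1) / (d + c)) \<le> (1 - S) * ((C - 1) / (S + C))"
    using assms by (intro mult_mono) auto
  moreover have "(2 * (s + c - 1) / (s + c + 1))\<^sup>2 \<le> (ln (S + C))\<^sup>2"
  proof (rule power_mono)
    have "2 * (s + c - 1) / (s + c + 1) \<le> ln (s + c)"
      using assms ln_ge_ratio[of "s + c"] by simp
    also have "\<dots> \<le> ln (S + C)" using assms by simp
    finally show "2 * (s + c - 1) / (s + c + 1) \<le> ln (S + C)" .
  qed (use assms in simp)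
  ultimately show ?thesis using assms(8) by linarith
qed

text \<open>Interval arithmetic for \<open>u\<close> between \<open>a\<close> and \<open>b\<close>:
  \<open>s\<close> bounds the sine below by its cubic Taylor polynomial at \<open>a\<close>,
  \<open>b\<close> bounds it above, and \<open>c\<close> bounds cosh below through v^2 >= 1 - b^2.
  What remains is one inequality between numerals.\<close>

lemma sin_cosh_interval:
  fixes u v a b :: real
  assumes uv: "u\<^sup>2 + v\<^sup>2 = 1" and ab: "0 \<le> a" "a \<le> u" "u \<le> b" "b < 1"
    and "s = a - a ^ 3 / 6" "c = 1 + (1 - b\<^sup>2) / 2 + (1 - b\<^sup>2)\<^sup>2 / 24"
    and "0.5853 \<le> (2 * (s + c - 1) / (s + c + 1))\<^sup>2 + 2 * ((1 - b) * ((c - 1) / (b + c)))"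
  shows "0.5853 \<le> (ln (sin u + cosh v))\<^sup>2 + 2 * ((1 - sin u) * ((cosh v - 1) / (sin u + cosh v)))"
proof (rule sin_cosh_piece[where d = b and c = c and s = s])
  have "a ^ 3 \<le> a" using ab power_decreasing[of 1 3 a] by simp
  then show "0 \<le> s" using assms by simp
  show "s \<le> sin u"
    using sin_ge_taylor3[of a] sin_monotone_2pi_le[of a u] ab pi_gt3 assms by fastforce
  then show "0 \<le> sin u" using \<open>0 \<le> s\<close> by simp
  show "sin u \<le> b" using ab sin_x_le_x[of u] by simp
  have "b\<^sup>2 \<le> 1" using ab by (simp add: power_le_one)
  then show "1 \<le> c" using assms by simp
  have "u\<^sup>2 \<le> b\<^sup>2" using ab by (intro power_mono) auto
  then have v: "1 - b\<^sup>2 \<le> v\<^sup>2" using uv by simp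
  moreover have "(1 - b\<^sup>2)\<^sup>2 \<le> (v\<^sup>2)\<^sup>2" using v \<open>b\<^sup>2 \<le> 1\<close> by (intro power_mono) auto
  ultimately have "c \<le> 1 + v\<^sup>2 / 2 + v ^ 4 / 24"
    unfolding \<open>c = _\<close> by (intro add_mono divide_right_mono) (simp_all flip: power_mult)
  then show "c \<le> cosh v" using cosh_ge_taylor4[of v] by (rule order_trans)
qed (use assms in auto)

text \<open>Here \<open>a\<close> is -u, and the argument term alone suffices. It increases with
  \<open>sin a\<close> and \<open>cosh v\<close>, so these may be replaced by the lower bounds
  \<open>5 * a / 6\<close> and \<open>c\<close>.\<close>

lemma sin_cosh_ge_neg:
  fixes a v :: real
  assumes uv: "a\<^sup>2 + v\<^sup>2 = 1" and a: "0 \<le> a" "a \<le> 0.95"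
  shows "0.5853 \<le> 2 * ((1 + sin a) * (cosh v - 1) / (cosh v - sin a))"
proof -
  define c where "c = 1 + (1 - a\<^sup>2) / 2"
  have a1: "a\<^sup>2 \<le> 1" using a by (simp add: power_le_one)
  have a3: "a ^ 3 \<le> a" using a power_decreasing[of 1 3 a] by simp
  have s: "5 * a / 6 \<le> sin a" "sin a < 1"
    using sin_ge_taylor3[of a] a a3 sin_x_le_x[of a] by auto
  have c: "c \<le> cosh v" proof -
    have "c = 1 + v\<^sup>2 / 2" using uv by (simp add: c_def flip: uv)
    also have "\<dots> \<le> 1 + v\<^sup>2 / 2 + v ^ 4 / 24" by simp
    also note cosh_ge_taylor4
    finally show ?thesis .
  qed
  have "c \<ge> 1" using a1 by (simp add: c_def)
  have "0.5853 \<le> 2 * ((1 + 5 * a / 6) * (c - 1) / (c - 5 * a / 6))"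
  proof -
    have "c - 5 * a / 6 > 0" using \<open>c \<ge> 1\<close> a by simp
    moreover have "0.5853 * (c - 5 * a / 6) \<le> 2 * ((1 + 5 * a / 6) * (c - 1))"
    proof -
      have "a\<^sup>2 * (19 / 20 - a) \<ge> 0" "a * (19 / 20 - a) \<ge> 0" using a by simp_all
      moreover have "a\<^sup>2 * (19 / 20 - a) = 19 / 20 * a\<^sup>2 - a ^ 3"
        "a * (19 / 20 - a) = 19 / 20 * a - a\<^sup>2"
        by (simp_all add: field_simps power2_eq_square power3_eq_cube)
      moreover have "a \<le> 19 / 20" using a by simp
      ultimately have "0 \<le> 2441 / 20000 + 5 / 6 * 15853 / 10000 * a - 14147 / 20000 * a\<^sup>2 - 5 / 6 * a ^ 3"
        using a(1) by linarith
      also have "\<dots> = 2 * ((1 + 5 * a / 6) * (c - 1)) - 0.5853 * (c - 5 * a / 6)"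
        by (simp add: c_def field_simps power2_eq_square power3_eq_cube)
      finally show ?thesis by simp
    qed
    ultimately show ?thesis by (simp add: field_simps)
  qed
  also have "\<dots> \<le> 2 * ((1 + sin a) * (cosh v - 1) / (cosh v - sin a))"
  proof -
    have "(c - 1) / (c - 5 * a / 6) \<le> (c - 1) / (c - sin a)"
      using s \<open>c \<ge> 1\<close> a by (intro divide_left_mono) auto
    also have "\<dots> \<le> (cosh v - 1) / (cosh v - sin a)"
    proof -
      have "(cosh v - 1) * (c - sin a) - (c - 1) * (cosh v - sin a) = (1 - sin a) * (cosh v - c)" by algebra
      also have "\<dots> \<ge> 0" using c s by simp
      finally show ?thesis using c s \<open>c \<ge> 1\<close> by (simp add: frac_le_eq divide_simps)
    qed
    finally have "(1 + 5 * a / 6) * ((c - 1) / (c - 5 * a / 6)) \<le> (1 + sin a) * ((cosh v - 1) / (cosh v - sin a))"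
      using s a \<open>c \<ge> 1\<close> by (intro mult_mono) auto
    then show ?thesis by simp
  qed
  finally show ?thesis .
qed

text \<open>Near -1 the argument term degenerates, but 1 + sin is so small in modulus that its
  logarithm alone is large enough.\<close>

lemma sin_cosh_left_tip:
  fixes a v :: real
  assumes uv: "a\<^sup>2 + v\<^sup>2 = 1" and a: "0.95 < a"
  shows "0.5853 \<le> (ln (cosh v - sin a))\<^sup>2"
proof -
  have "a \<le> 1" "v\<^sup>2 \<le> 0.0975"
  proof -
    have "a\<^sup>2 \<le> 1" using uv zero_le_power2[of v] by linarith
    then show "a \<le> 1" using abs_square_le_1[of a] by simp
    have "0.95\<^sup>2 \<le> a\<^sup>2" using a by (intro power_mono) auto
    then show "v\<^sup>2 \<le> 0.0975" using uv by (simp add: power2_eq_square)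
  qed
  define x where "x = \<bar>v\<bar>"
  have x: "0 \<le> x" "x \<le> 1" "x\<^sup>2 \<le> 0.0975"
    using \<open>v\<^sup>2 \<le> 0.0975\<close> power2_le_imp_le[of x 1] by (auto simp: x_def)
  have "cosh x \<le> 1 + x\<^sup>2"
  proof -
    have "exp x \<le> 1 + x + x\<^sup>2" using x by (intro exp_bound)
    moreover have "exp (- x) \<le> 1 - x + x\<^sup>2"
    proof -
      have "(1 - x + x\<^sup>2) * (1 + x + x\<^sup>2 / 2) = 1 + (x\<^sup>2 + x ^ 3 + x ^ 4) / 2"
        by (simp add: field_simps eval_nat_numeral)
      then have "1 \<le> (1 - x + x\<^sup>2) * (1 + x + x\<^sup>2 / 2)" using x by simp
      also have "\<dots> \<le> (1 - x + x\<^sup>2) * exp x"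
        using x exp_lower_Taylor_quadratic[of x] by (intro mult_left_mono) auto
      finally show ?thesis by (simp add: exp_minus divide_simps)
    qed
    ultimately show ?thesis by (simp add: cosh_field_def)
  qed
  then have "cosh v \<le> 1.0975" using x by (simp add: x_def)
  moreover have "sin a \<ge> 0.8"
    using sin_ge_taylor3[of "0.95"] sin_monotone_2pi_le[of "0.95" a] a \<open>a \<le> 1\<close> pi_gt3
    by (simp add: eval_nat_numeral)
  ultimately have y: "cosh v - sin a \<le> 0.3" by simp
  have y0: "cosh v - sin a > 0"
    using sin_x_le_x[of a] a \<open>a \<le> 1\<close> cosh_real_ge_1[of v] sin_monotone_2pi[of a "pi / 2"] pi_gt3 by simp
  note y
  \<comment> \<open>0.766^2 still exceeds 0.5853. The exponent is halved because 1 + x <= exp x is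
    too weak at -0.766.\<close>
  also have "(0.3::real) \<le> (1 + (- 0.383))\<^sup>2" by (simp add: power2_eq_square)
  also have "\<dots> \<le> (exp (- 0.383))\<^sup>2"
    by (intro power_mono exp_ge_add_one_self) auto
  also have "\<dots> = exp (- 0.766)" by (simp flip: exp_of_nat_mult)
  finally have "ln (cosh v - sin a) \<le> ln (exp (- 0.766))"
    using y0 by (subst ln_le_cancel_iff) auto
  then have "0.766\<^sup>2 \<le> (- ln (cosh v - sin a))\<^sup>2"
    by (intro power_mono) auto
  then show ?thesis by (simp add: power2_eq_square)
qed

text \<open>For u + iv = \<zeta> the modulus of 1 + sin \<zeta> is y = sin u + cosh v, and its argument Y satisfies
  Y^2 \<ge> 2 (1 - cos Y) = 2 (1 - sin u) (cosh v - 1) / y.  So the right-hand side bounds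
  |log (1 + sin \<zeta>)|^2 from below; 0.5853 exceeds (5/4 ln (1 + sin 1))^2 = 0.5827...\<close>

lemma sin_cosh_circle_bound:
  fixes u v :: real
  assumes uv: "u\<^sup>2 + v\<^sup>2 = 1" and less: "sin u + cosh v < 1 + sin 1"
  shows "0.5853 \<le> (ln (sin u + cosh v))\<^sup>2 + 2 * ((1 - sin u) * ((cosh v - 1) / (sin u + cosh v)))"
proof -
  have "u < 0.43" using sin_plus_cosh_ge[OF uv] less by linarith
  \<comment> \<open>The first case uses the logarithm alone and the second the argument alone. The
    rest need both terms, on pieces that shorten towards 0.43, where the slack shrinks.\<close>
  then consider "u < - 0.95" | "- 0.95 \<le> u" "u \<le> 0" | "0 \<le> u" "u \<le> 0.2" | "0.2 \<le> u" "u \<le> 0.33"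
    | "0.33 \<le> u" "u \<le> 0.385" | "0.385 \<le> u" "u \<le> 0.43"
    by linarith
  then show ?thesis
  proof cases
    case 1
    have "u\<^sup>2 \<le> 1" using uv zero_le_power2[of v] by linarith
    then have "u \<ge> - 1" using abs_square_le_1[of u] by simp
    have "sin (- u) \<le> - u" using 1 by (intro sin_x_le_x) simp
    then have "sin u + cosh v \<ge> 0" using \<open>u \<ge> - 1\<close> cosh_real_ge_1[of v] by simp
    then have "(1 - sin u) * ((cosh v - 1) / (sin u + cosh v)) \<ge> 0"
      using cosh_real_ge_1[of v] by simp
    moreover have "0.5853 \<le> (ln (sin u + cosh v))\<^sup>2"
      using sin_cosh_left_tip[of "- u" v] uv 1 by (simp add: add.commute)
    ultimately show ?thesis by (smt (verit))
  next
    case 2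
    then have "0.5853 \<le> 2 * ((1 - sin u) * ((cosh v - 1) / (sin u + cosh v)))"
      using sin_cosh_ge_neg[of "- u" v] uv by (simp add: add.commute)
    then show ?thesis by (rule order_trans) simp
  next
    case 3
    show ?thesis
      by (rule sin_cosh_interval[OF uv _ 3 _ refl refl]) (simp_all add: power2_eq_square eval_nat_numeral)
  next
    case 4
    show ?thesis
      by (rule sin_cosh_interval[OF uv _ 4 _ refl refl]) (simp_all add: power2_eq_square eval_nat_numeral)
  next
    case 5
    show ?thesis
      by (rule sin_cosh_interval[OF uv _ 5 _ refl refl]) (simp_all add: power2_eq_square eval_nat_numeral)
  next
    case 6
    show ?thesis
      by (rule sin_cosh_interval[OF uv _ 6 _ refl refl]) (simp_all add: power2_eq_square eval_nat_numeral)
  qed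
qed

section \<open>Subordination\<close>

text \<open>By compactness the frontier of the open image of the disc under the target lies in the
  image of the unit circle. The connected image of \<open>p\<close> meets the open image at
  \<open>p 0\<close> and avoids that frontier, hence stays inside; the inverse of the target after
  \<open>p\<close> is the Schwarz function.\<close>

lemma subordinate_if_avoids_boundary:
  assumes p: "p holomorphic_on ball 0 1" and \<phi>: "\<phi> holomorphic_on ball 0 1"
    and cont: "continuous_on (cball 0 1) \<phi>" and inj: "inj_on \<phi> (ball 0 1)" and p0: "p 0 = \<phi> 0"
    and avoid: "\<And>z \<zeta>. z \<in> ball 0 1 \<Longrightarrow> norm \<zeta> = 1 \<Longrightarrow> p z \<noteq> \<phi> \<zeta>"
  shows "p \<prec>\<^sub>D \<phi>"
proof -
  have op: "open (\<phi> ` ball 0 1)"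
    by (rule open_mapping_thm3[OF \<phi> open_ball inj])
  have sub: "p ` ball 0 1 \<subseteq> \<phi> ` ball 0 1"
  proof (rule ccontr)
    assume "\<not> p ` ball 0 1 \<subseteq> \<phi> ` ball 0 1"
    moreover have "p 0 \<in> p ` ball 0 1 \<inter> \<phi> ` ball 0 1"
      using p0 by (metis IntI centre_in_ball image_eqI zero_less_one)
    moreover have "connected (p ` ball 0 1)"
      using p by (intro connected_continuous_image holomorphic_on_imp_continuous_on) auto
    ultimately obtain y where y: "y \<in> p ` ball 0 1" "y \<in> frontier (\<phi> ` ball 0 1)"
      using connected_Int_frontier[of "p ` ball 0 1" "\<phi> ` ball 0 1"] by blast
    have "closure (\<phi> ` ball 0 1) \<subseteq> \<phi> ` cball 0 1"
      using cont by (intro closure_minimal compact_imp_closed compact_continuous_image image_mono) auto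
    then obtain \<zeta> where \<zeta>: "y = \<phi> \<zeta>" "norm \<zeta> \<le> 1"
      using y(2) by (auto simp: frontier_def)
    moreover have "y \<notin> \<phi> ` ball 0 1"
      using y(2) op frontier_disjoint_eq by blast
    ultimately have "norm \<zeta> = 1" by (cases "norm \<zeta> = 1") auto
    then show False using y(1) avoid \<zeta>(1) by blast
  qed
  obtain g where g: "g holomorphic_on \<phi> ` ball 0 1" "\<And>z. z \<in> ball 0 1 \<Longrightarrow> g (\<phi> z) = z"
    using holomorphic_has_inverse[OF \<phi> open_ball inj] by metis
  have "(\<lambda>z. g (p z)) holomorphic_on ball 0 1"
    using holomorphic_on_compose_gen[OF p g(1)] sub by (auto simp: o_def)
  moreover have "g (p 0) = 0" using g(2)[of 0] p0 by simp
  moreover have "norm (g (p z)) < 1 \<and> p z = \<phi> (g (p z))" if "z \<in> ball 0 1" for z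
  proof -
    have "p z \<in> \<phi> ` ball 0 1" using sub that by (meson imageI subsetD)
    then obtain x where "p z = \<phi> x" "x \<in> ball 0 1" by (rule imageE)
    then show ?thesis using g(2)[of x] by simp
  qed
  ultimately show ?thesis
    unfolding subordinate_def by (intro conjI p \<phi> exI[of _ "\<lambda>z. g (p z)"]) auto
qed

text \<open>Zero-freeness of \<open>p\<close> is not presupposed. A primitive \<open>Q\<close> of
  the quotient divided by z makes \<open>p z * exp (- Q z)\<close> constant, which yields the
  logarithm and the absence of zeros together.\<close>

lemma obtain_logarithm:
  assumes p: "p holomorphic_on ball 0 1" and p0: "p 0 = 1"
    and f: "(\<lambda>z. z * deriv p z / p z) holomorphic_on ball 0 1"
  obtains Q where "Q holomorphic_on ball 0 1" "Q 0 = 0" "\<And>z. z \<in> ball 0 1 \<Longrightarrow> p z = exp (Q z)"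
    "\<And>z. z \<in> ball 0 1 \<Longrightarrow> z * deriv Q z = z * deriv p z / p z"
proof -
  define f where "f = (\<lambda>z. z * deriv p z / p z)"
  have holf: "f holomorphic_on ball 0 1" using assms by (simp add: f_def)
  have dp: "(p has_field_derivative deriv p z) (at z)" if "z \<in> ball 0 1" for z
    using holomorphic_derivI[OF p open_ball that] .
  \<comment> \<open>At a zero of p the quotient is 0 by convention, so the equation there comes from continuity;
     being linear, it then excludes zeros altogether.\<close>
  have ode: "z * deriv p z = f z * p z" if z: "z \<in> ball 0 1" for z
  proof (cases "p z = 0")
    case True
    obtain r where r: "0 < r" "ball z r \<subseteq> ball 0 1" "\<And>x. x \<in> ball z r - {z} \<Longrightarrow> p x \<noteq> 0"
      using isolated_zeros[OF p open_ball connected_ball z True, of 0] p0 by auto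
    have "((\<lambda>x. x * deriv p x - f x * p x) \<longlongrightarrow> z * deriv p z - f z * p z) (at z)"
    proof -
      have "isCont (\<lambda>x. x * deriv p x - f x * p x) z"
        by (rule continuous_on_interior[of "ball 0 1"])
          (use z in \<open>auto intro!: holomorphic_on_imp_continuous_on holomorphic_intros p holf holomorphic_deriv\<close>)
      then show ?thesis by (simp add: isCont_def)
    qed
    moreover have "eventually (\<lambda>x. x * deriv p x - f x * p x = 0) (at z)"
      unfolding eventually_at using r by (intro exI[of _ r]) (auto simp: f_def dist_commute)
    ultimately have "z * deriv p z - f z * p z = 0"
      by (intro tendsto_unique[OF at_neq_bot _ tendsto_eventually])
    then show ?thesis by simp
  qed (simp add: f_def)
  \<comment> \<open>Division by z is a removable singularity; the value at 0 is the one that makes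
    \<open>g\<close> holomorphic.\<close>
  define g where "g = (\<lambda>z. if z = 0 then deriv f 0 else f z / z)"
  have "g holomorphic_on ball 0 1"
    by (rule pole_theorem_0[of f _ 0]) (auto simp: holf g_def, simp add: f_def)
  then obtain Q0 where Q0: "\<And>z. z \<in> ball 0 1 \<Longrightarrow> (Q0 has_field_derivative g z) (at z within ball 0 1)"
    using holomorphic_convex_primitive'[of "ball 0 1" g] by auto
  define Q where "Q z = Q0 z - Q0 0" for z
  have dQ: "(Q has_field_derivative g z) (at z)" if "z \<in> ball 0 1" for z
    unfolding Q_def[abs_def] using Q0[OF that] that
    by (auto simp: at_within_open[OF that] intro!: derivative_eq_intros)
  have f0: "f 0 = 0" by (simp add: f_def)
  have zg: "z * g z = f z" for z by (simp add: g_def f0)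
  have pg: "deriv p z = g z * p z" if z: "z \<in> ball 0 1" for z
  proof (cases "z = 0")
    case True
    have "(f has_field_derivative deriv p 0) (at 0)"
    proof -
      have "((\<lambda>z. z * deriv p z / p z) has_field_derivative
          ((1 * deriv p 0 + deriv (deriv p) 0 * 0) * p 0 - 0 * deriv p 0 * deriv p 0) / (p 0 * p 0)) (at 0)"
        using p0 by (intro DERIV_divide DERIV_mult DERIV_ident dp
          holomorphic_derivI[OF holomorphic_deriv[OF p open_ball] open_ball]) auto
      then show ?thesis by (simp add: p0 f_def)
    qed
    then show ?thesis using True p0 by (simp add: g_def DERIV_imp_deriv)
  next
    case False
    then show ?thesis using ode[OF z] by (simp add: g_def field_simps)
  qed
  have "((\<lambda>z. p z * exp (- Q z)) has_field_derivative 0) (at z within ball 0 1)" if "z \<in> ball 0 1" for z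
  proof -
    have "((\<lambda>z. p z * exp (- Q z)) has_field_derivative
        p z * (exp (- Q z) * - g z) + deriv p z * exp (- Q z)) (at z)"
      by (intro DERIV_mult' dp that DERIV_chain2[OF DERIV_exp] DERIV_minus dQ)
    then show ?thesis
      using pg[OF that] by (simp add: algebra_simps has_field_derivative_at_within)
  qed
  then obtain c where c: "\<And>z. z \<in> ball 0 1 \<Longrightarrow> p z * exp (- Q z) = c"
    using has_field_derivative_zero_constant[of "ball 0 1" "\<lambda>z. p z * exp (- Q z)"] by auto
  have "c = 1" using c[of 0] p0 by (simp add: Q_def)
  then have "p z = exp (Q z)" if "z \<in> ball 0 1" for z
    using c[OF that] \<open>c = 1\<close> by (simp add: exp_minus field_simps)
  moreover have "Q holomorphic_on ball 0 1"
    unfolding holomorphic_on_open[OF open_ball] using dQ by blast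
  moreover have "z * deriv Q z = z * deriv p z / p z" if "z \<in> ball 0 1" for z
    using zg[of z] unfolding DERIV_imp_deriv[OF dQ[OF that]] by (simp only: f_def)
  moreover have "Q 0 = 0" by (simp add: Q_def)
  ultimately show ?thesis using that by blast
qed

text \<open>The bounds 8/9 and 10/9 hold for \<open>F\<close>, which is \<open>\<beta>\<close> times
  the logarithm \<open>P\<close>. Since 8/9 <= \<open>\<beta> * l\<close>, dividing by
  \<open>\<beta>\<close> gives \<open>l\<close> and 5/4 times \<open>l\<close>, the ratio of 10/9 to
  8/9.\<close>

lemma nephroid_hyp_logarithm:
  assumes hyp: "nephroid_hyp \<beta> p" and l: "l > 0" and \<beta>: "\<beta> \<ge> (8 / 9) / l"
  obtains P where "\<And>z. z \<in> ball 0 1 \<Longrightarrow> p z = exp (P z)"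
    "\<And>z. z \<in> ball 0 1 \<Longrightarrow> \<bar>Re (P z)\<bar> < l" "\<And>z. z \<in> ball 0 1 \<Longrightarrow> norm (P z) < 5 / 4 * l"
proof -
  have "\<beta> > 0" using l \<beta> by (smt (verit) divide_pos_pos)
  obtain w where p: "p holomorphic_on ball 0 1" "p 0 = 1"
    and h: "(\<lambda>z. 1 + complex_of_real \<beta> * (z * deriv p z / p z)) holomorphic_on ball 0 1"
    and w: "w holomorphic_on ball 0 1" "w 0 = 0" "\<And>z. norm z < 1 \<Longrightarrow> norm (w z) < 1"
    and eq: "\<And>z. z \<in> ball 0 1 \<Longrightarrow> 1 + complex_of_real \<beta> * (z * deriv p z / p z) = \<phi>_Ne (w z)"
    using hyp unfolding nephroid_hyp_def subordinate_def by auto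
  have "(\<lambda>z. ((1 + complex_of_real \<beta> * (z * deriv p z / p z)) - 1) / of_real \<beta>) holomorphic_on ball 0 1"
    using \<open>\<beta> > 0\<close> by (intro holomorphic_intros h) auto
  then have "(\<lambda>z. z * deriv p z / p z) holomorphic_on ball 0 1"
    using \<open>\<beta> > 0\<close> by simp
  then obtain P where P: "P holomorphic_on ball 0 1" "P 0 = 0" "\<And>z. z \<in> ball 0 1 \<Longrightarrow> p z = exp (P z)"
    "\<And>z. z \<in> ball 0 1 \<Longrightarrow> z * deriv P z = z * deriv p z / p z"
    using obtain_logarithm[OF p] by metis
  define F where "F z = of_real \<beta> * P z" for z
  have F: "F holomorphic_on ball 0 1" "F 0 = 0"
    unfolding F_def[abs_def] using P(1,2) by (auto intro!: holomorphic_intros)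
  have "z * deriv F z = w z - w z ^ 3 / 3" if z: "z \<in> ball 0 1" for z
  proof -
    have "deriv F z = of_real \<beta> * deriv P z"
      unfolding F_def using holomorphic_on_imp_differentiable_at[OF P(1) open_ball z] by simp
    then have "z * deriv F z = of_real \<beta> * (z * deriv P z)" by simp
    then show ?thesis using eq[OF z] by (simp add: P(4)[OF z] \<phi>_Ne_def algebra_simps)
  qed
  then have bounds: "\<bar>Re (F z)\<bar> < 8 / 9" "norm (F z) < 10 / 9" if "z \<in> ball 0 1" for z
    using nephroid_ode_bounds[OF F _ _ that, of w] Schwarz_Lemma(1)[OF w] by auto
  have l': "8 / 9 \<le> \<beta> * l" using \<beta> l by (simp add: field_simps)
  show ?thesis
  proof
    show "p z = exp (P z)" if "z \<in> ball 0 1" for z using P(3)[OF that] .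
    show "\<bar>Re (P z)\<bar> < l" if "z \<in> ball 0 1" for z
    proof -
      have "\<beta> * \<bar>Re (P z)\<bar> = \<bar>Re (F z)\<bar>" using \<open>\<beta> > 0\<close> by (simp add: F_def abs_mult)
      also have "\<dots> < \<beta> * l" using bounds(1)[OF that] l' by (rule less_le_trans)
      finally show ?thesis using \<open>\<beta> > 0\<close> by simp
    qed
    show "norm (P z) < 5 / 4 * l" if "z \<in> ball 0 1" for z
    proof -
      have "\<beta> * norm (P z) = norm (F z)" using \<open>\<beta> > 0\<close> by (simp add: F_def norm_mult)
      also have "\<dots> < 10 / 9" by (rule bounds(2)[OF that])
      also have "\<dots> \<le> \<beta> * (5 / 4 * l)" using l' by simp
      finally show ?thesis using \<open>\<beta> > 0\<close> by simp
    qed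
  qed
qed

section \<open>The extremal function\<close>

lemma nephroid_hyp_extremal:
  assumes "\<beta> > 0"
  shows "nephroid_hyp \<beta> (\<lambda>z. exp ((z - z ^ 3 / 9) / of_real \<beta>))"
proof -
  define E where "E z = exp ((z - z ^ 3 / 9) / of_real \<beta>)" for z :: complex
  have "(E has_field_derivative E z * ((1 - z\<^sup>2 / 3) / of_real \<beta>)) (at z)" for z
    unfolding E_def by (auto intro!: derivative_eq_intros simp: assms[THEN less_imp_neq, symmetric] power2_eq_square)
  then have dE: "deriv E z = E z * ((1 - z\<^sup>2 / 3) / of_real \<beta>)" for z
    by (rule DERIV_imp_deriv)
  have E0: "E z \<noteq> 0" for z by (simp add: E_def)
  \<comment> \<open>The exponent was chosen so that the hypothesis holds with the identity as
    Schwarz function.\<close>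
  have "(\<lambda>z. 1 + complex_of_real \<beta> * (z * deriv E z / E z)) = \<phi>_Ne"
    unfolding dE using E0 assms by (auto simp: \<phi>_Ne_def fun_eq_iff power2_eq_square power3_eq_cube field_simps)
  moreover have "\<phi>_Ne holomorphic_on ball 0 1"
    unfolding \<phi>_Ne_def by (auto intro!: holomorphic_intros)
  then have "\<phi>_Ne \<prec>\<^sub>D \<phi>_Ne"
    unfolding subordinate_def by (intro conjI exI[of _ "\<lambda>z. z"]) auto
  moreover have "E holomorphic_on ball 0 1"
    unfolding E_def using assms by (intro holomorphic_intros) auto
  ultimately have "nephroid_hyp \<beta> E"
    unfolding nephroid_hyp_def by (simp add: E_def)
  then show ?thesis unfolding E_def .
qed

text \<open>Injectivity and symmetry under conjugation force the Schwarz function to be real at real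
  points, where the target obeys the bound \<open>c\<close>. Letting the real point tend to
  \<open>\<sigma>\<close> pushes the extremal function past \<open>c\<close>. The sign
  \<open>\<sigma>\<close> treats upper and lower bounds at once.\<close>

lemma extremal_not_subordinate:
  fixes \<sigma> \<beta> c :: real and g :: "real \<Rightarrow> real"
  assumes inj: "inj_on \<phi> (ball 0 1)" and cnj: "\<And>z. \<phi> (cnj z) = cnj (\<phi> z)"
    and real: "\<And>y. \<bar>y\<bar> < 1 \<Longrightarrow> \<phi> (of_real y) = of_real (g y)"
    and bound: "\<And>y. \<bar>y\<bar> < 1 \<Longrightarrow> \<sigma> * g y \<le> \<sigma> * c"
    and \<sigma>: "\<bar>\<sigma>\<bar> = 1" and "\<beta> > 0" and \<beta>: "\<sigma> * exp (\<sigma> * (8 / 9) / \<beta>) > \<sigma> * c"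
  shows "\<not> (\<lambda>z. exp ((z - z ^ 3 / 9) / of_real \<beta>)) \<prec>\<^sub>D \<phi>"
proof
  assume "(\<lambda>z. exp ((z - z ^ 3 / 9) / of_real \<beta>)) \<prec>\<^sub>D \<phi>"
  then obtain w where w: "\<And>z. z \<in> ball 0 1 \<Longrightarrow> norm (w z) < 1"
      "\<And>z. z \<in> ball 0 1 \<Longrightarrow> exp ((z - z ^ 3 / 9) / of_real \<beta>) = \<phi> (w z)"
    unfolding subordinate_def by blast
  define e where "e t = \<sigma> * exp ((\<sigma> * t - (\<sigma> * t) ^ 3 / 9) / \<beta>)" for t
  have "e t \<le> \<sigma> * c" if t: "0 < t" "t < 1" for t
  proof -
    define x where "x = \<sigma> * t"
    have "norm (complex_of_real x) < 1"
      unfolding norm_of_real x_def using t \<sigma> by (simp add: abs_mult)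
    then have x: "complex_of_real x \<in> ball 0 1" by simp
    have eq: "of_real (exp ((x - x ^ 3 / 9) / \<beta>)) = \<phi> (w (of_real x))"
      using w(2)[OF x] by (simp flip: exp_of_real)
    have "\<phi> (cnj (w (of_real x))) = \<phi> (w (of_real x))"
      unfolding cnj eq[symmetric] by simp
    then have "cnj (w (of_real x)) = w (of_real x)"
      using inj w(1)[OF x] by (auto dest: inj_onD)
    then obtain y where y: "w (of_real x) = of_real y"
      by (metis Reals_cnj_iff Reals_cases)
    have "\<bar>y\<bar> < 1" using w(1)[OF x] by (simp add: y)
    then have "exp ((x - x ^ 3 / 9) / \<beta>) = g y" "\<sigma> * g y \<le> \<sigma> * c"
      using eq real bound by (simp_all add: y del: of_real_exp)
    then show ?thesis by (simp add: e_def x_def)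
  qed
  then have "eventually (\<lambda>t. e t \<le> \<sigma> * c) (at_left 1)"
    by (intro eventually_at_leftI[of 0]) auto
  moreover have "(e \<longlongrightarrow> e 1) (at_left 1)"
    unfolding e_def using \<open>\<beta> > 0\<close> by (intro tendsto_intros) auto
  ultimately have "e 1 \<le> \<sigma> * c"
    by (intro tendsto_upperbound) auto
  moreover have "\<sigma> ^ 3 = \<sigma>" using \<sigma> by (auto simp: abs_eq_iff')
  then have "e 1 = \<sigma> * exp (\<sigma> * (8 / 9) / \<beta>)"
    by (simp add: e_def)
  ultimately show False using \<beta> by simp
qed

section \<open>Boundary values of the three target functions\<close>

lemma norm_exp_minus_one_le: "norm (exp z - 1) \<le> norm z * exp (norm z)" for z :: complex
proof -
  have "norm (exp z - exp 0) \<le> exp (norm z) * norm (z - 0)"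
  proof (rule field_differentiable_bound[of "cball 0 (norm z)" exp exp])
    fix x :: complex assume "x \<in> cball 0 (norm z)"
    then show "norm (exp x) \<le> exp (norm z)"
      using norm_exp[of x] by (simp add: order_trans[OF complex_Re_le_cmod])
  qed (auto intro: DERIV_exp[THEN has_field_derivative_at_within])
  then show ?thesis by (simp add: mult.commute)
qed

text \<open>With \<open>S\<close> and \<open>C\<close> as in the proof, the squared modulus is (1 +
  S C)^2 + (1 - S^2)(C^2 - 1), a perfect square.\<close>

lemma norm_1_plus_sin: "norm (1 + sin z) = sin (Re z) + cosh (Im z)" for z :: complex
proof -
  define S C where "S = sin (Re z)" and "C = cosh (Im z)"
  have "(norm (1 + sin z))\<^sup>2 = (1 + S * C)\<^sup>2 + (cos (Re z) * sinh (Im z))\<^sup>2"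
    by (simp add: cmod_power2 Re_sin Im_sin S_def C_def cosh_field_def sinh_field_def)
  also have "\<dots> = (1 + S * C)\<^sup>2 + (1 - S\<^sup>2) * (C\<^sup>2 - 1)"
    by (simp add: power_mult_distrib S_def C_def cos_squared_eq sinh_square_eq)
  also have "\<dots> = (S + C)\<^sup>2" by (simp add: power2_eq_square algebra_simps)
  finally have "(norm (1 + sin z))\<^sup>2 = (S + C)\<^sup>2" .
  moreover have "S + C \<ge> 0"
    using sin_ge_minus_one[of "Re z"] cosh_real_ge_1[of "Im z"] unfolding S_def C_def by linarith
  ultimately show ?thesis unfolding S_def C_def by (metis norm_ge_zero power2_eq_iff_nonneg)
qed

text \<open>The modulus of the equation determines \<open>Re P\<close>, and its real part determines
  \<open>cos (Im P)\<close>. Together they force \<open>norm P\<close> beyond the allowed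
  disc.\<close>

lemma exp_neq_sin_boundary:
  assumes P: "norm P < 5 / 4 * ln (1 + sin 1)" "Re P < ln (1 + sin 1)" and \<zeta>: "norm \<zeta> = 1"
  shows "exp P \<noteq> \<phi>_sin \<zeta>"
proof
  assume eq: "exp P = \<phi>_sin \<zeta>"
  define u v where "u = Re \<zeta>" and "v = Im \<zeta>"
  define y where "y = sin u + cosh v"
  have uv: "u\<^sup>2 + v\<^sup>2 = 1" using \<zeta> cmod_power2[of \<zeta>] by (simp add: u_def v_def)
  have expX: "exp (Re P) = y"
    using norm_1_plus_sin[of \<zeta>] eq by (simp add: \<phi>_sin_def u_def v_def y_def flip: norm_exp_eq_Re)
  then have "y > 0" by (metis exp_gt_zero)
  have X: "Re P = ln y" using expX by (metis ln_exp)
  have sin1: "sin (1::real) > 0" by (rule sin_gt_zero_02) auto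
  have "y < exp (ln (1 + sin 1))" unfolding expX[symmetric] using P(2) by simp
  then have y: "y < 1 + sin 1" using sin1 by simp
  have "y * cos (Im P) = 1 + sin u * cosh v"
    using arg_cong[OF eq, of Re] expX by (simp add: \<phi>_sin_def Re_exp Re_sin u_def v_def cosh_field_def)
  then have "y * (1 - cos (Im P)) = (1 - sin u) * (cosh v - 1)"
    by (simp add: y_def algebra_simps)
  then have "(1 - sin u) * ((cosh v - 1) / y) = 1 - cos (Im P)"
    using \<open>y > 0\<close> by (simp add: field_simps)
  \<comment> \<open>The cosine bound holds for every real number, so no choice of branch for the
    argument is involved.\<close>
  also have "\<dots> \<le> (Im P)\<^sup>2 / 2" using cos_ge_taylor2[of "Im P"] by simp
  finally have Y: "2 * ((1 - sin u) * ((cosh v - 1) / y)) \<le> (Im P)\<^sup>2" by linarith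
  have "0.5853 \<le> (ln y)\<^sup>2 + 2 * ((1 - sin u) * ((cosh v - 1) / y))"
    using sin_cosh_circle_bound[OF uv] y unfolding y_def .
  also have "\<dots> \<le> (Re P)\<^sup>2 + (Im P)\<^sup>2" using Y by (simp add: X)
  also have "\<dots> = (norm P)\<^sup>2" by (simp add: cmod_power2)
  also have "\<dots> \<le> (5 / 4 * 0.612)\<^sup>2"
    using P(1) ln_1_plus_sin1_upper by (intro power_mono) auto
  finally show False by (simp add: power2_eq_square)
qed

text \<open>For Re \<open>\<zeta>\<close> >= 0 the modulus on the nephroid is at least 5/3, against
  the strip. For Re \<open>\<zeta>\<close> < 0 the disc bound acts twice: \<open>exp P\<close> is
  too near 1 unless Re \<open>\<zeta>\<close> <= -2/5, and there the nephroid has real part at most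
  1/3, too small for \<open>exp P\<close>.\<close>

lemma exp_neq_nephroid_boundary:
  assumes P: "norm P < 5 / 4 * ln (5 / 3)" "Re P < ln (5 / 3)" and \<zeta>: "norm \<zeta> = 1"
  shows "exp P \<noteq> \<phi>_Ne \<zeta>"
proof
  assume eq: "exp P = \<phi>_Ne \<zeta>"
  define c s where "c = Re \<zeta>" and "s = Im \<zeta>"
  have s2: "s\<^sup>2 = 1 - c\<^sup>2" using \<zeta> cmod_power2[of \<zeta>] by (simp add: c_def s_def)
  have c2: "c\<^sup>2 \<le> 1" using s2 zero_le_power2[of s] by linarith
  then have c: "- 1 \<le> c" "c \<le> 1" by (auto simp: abs_square_le_1 abs_le_iff)
  have Re_G: "Re (\<zeta> - \<zeta> ^ 3 / 3) = 2 * c - 4 * c ^ 3 / 3"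
  proof -
    have "Re (\<zeta> - \<zeta> ^ 3 / 3) = c - (c ^ 3 - 3 * c * s\<^sup>2) / 3"
      by (simp add: c_def s_def power2_eq_square power3_eq_cube algebra_simps)
    then show ?thesis unfolding s2 by (simp add: power2_eq_square power3_eq_cube field_simps)
  qed
  have Im_G: "Im (\<zeta> - \<zeta> ^ 3 / 3) = 4 / 3 * s * s\<^sup>2"
  proof -
    have "Im (\<zeta> - \<zeta> ^ 3 / 3) = s - s * (3 * c\<^sup>2 - s\<^sup>2) / 3"
      by (simp add: c_def s_def power2_eq_square power3_eq_cube algebra_simps)
    then show ?thesis unfolding s2 by (simp add: power2_eq_square field_simps)
  qed
  have norm_G: "(norm (\<zeta> - \<zeta> ^ 3 / 3))\<^sup>2 = 16 / 9 - 4 / 3 * c\<^sup>2"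
  proof -
    have "(norm (\<zeta> - \<zeta> ^ 3 / 3))\<^sup>2 = (2 * c - 4 * c ^ 3 / 3)\<^sup>2 + 16 / 9 * (s\<^sup>2 * s\<^sup>2 * s\<^sup>2)"
      unfolding cmod_power2 Re_G Im_G by (simp add: power2_eq_square)
    then show ?thesis unfolding s2 by (simp add: power2_eq_square power3_eq_cube field_simps)
  qed
  have V: "exp P - 1 = \<zeta> - \<zeta> ^ 3 / 3" using eq by (simp add: \<phi>_Ne_def)
  \<comment> \<open>The fourth power clears the denominator of 5/4 and leaves an integer power of
    5/3.\<close>
  have "exp (norm P) ^ 4 < 1.9 ^ 4"
  proof -
    have "exp (norm P) ^ 4 = exp (4 * norm P)" by (simp flip: exp_of_nat_mult)
    also have "\<dots> < exp (5 * ln (5 / 3))" using P(1) by simp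
    also have "\<dots> = (5 / 3) ^ 5" by (subst exp_of_nat_mult[of 5, simplified]) simp
    also have "\<dots> \<le> 1.9 ^ 4" by (simp add: eval_nat_numeral)
    finally show ?thesis .
  qed
  then have exp_norm: "exp (norm P) < 1.9" by (rule power_less_imp_less_base) simp
  have "ln (5 / 3 :: real) \<le> 0.515"
  proof -
    have "5 / 3 \<le> (1 + 0.12875 + 0.12875\<^sup>2 / 2 :: real) ^ 4"
      by (simp add: power2_eq_square eval_nat_numeral)
    also have "\<dots> \<le> exp 0.12875 ^ 4"
      by (intro power_mono exp_lower_Taylor_quadratic) auto
    also have "\<dots> = exp 0.515" by (simp flip: exp_of_nat_mult)
    finally have "ln (5 / 3 :: real) \<le> ln (exp 0.515)" by (subst ln_le_cancel_iff) auto
    then show ?thesis by simp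
  qed
  then have norm_P: "norm P \<le> 0.644" using P(1) by simp
  show False
  proof (cases "c \<ge> 0")
    case True
    have "(exp (Re P))\<^sup>2 = (1 + (2 * c - 4 * c ^ 3 / 3))\<^sup>2 + (Im (\<zeta> - \<zeta> ^ 3 / 3))\<^sup>2"
    proof -
      have "exp P = 1 + (\<zeta> - \<zeta> ^ 3 / 3)" using V by (simp add: algebra_simps)
      then have "(norm (exp P))\<^sup>2 = (1 + Re (\<zeta> - \<zeta> ^ 3 / 3))\<^sup>2 + (Im (\<zeta> - \<zeta> ^ 3 / 3))\<^sup>2"
        by (simp add: cmod_power2)
      then show ?thesis unfolding Re_G by simp
    qed
    also have "\<dots> = 1 + 2 * (2 * c - 4 * c ^ 3 / 3) + (norm (\<zeta> - \<zeta> ^ 3 / 3))\<^sup>2"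
      unfolding cmod_power2 Re_G by (simp add: power2_eq_square algebra_simps)
    \<comment> \<open>The excess over (5/3)^2 is visibly nonnegative for 0 <= c <= 1 and vanishes at
      the critical point c = 1.\<close>
    also have "\<dots> = 25 / 9 + 4 * c * ((1 - c) * (1 + 2 / 3 * c))"
      unfolding norm_G by (simp add: power2_eq_square power3_eq_cube field_simps)
    also have "\<dots> \<ge> (5 / 3)\<^sup>2"
      using True c by (simp add: power2_eq_square)
    finally have "(5 / 3)\<^sup>2 \<le> (exp (Re P))\<^sup>2" .
    then have "5 / 3 \<le> exp (Re P)" by (rule power2_le_imp_le) simp
    moreover have "exp (Re P) < exp (ln (5 / 3))" using P(2) by (rule exp_less_mono)
    ultimately show False by simp
  next
    case False
    have "norm (exp P - 1) \<le> norm P * exp (norm P)" by (rule norm_exp_minus_one_le)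
    also have "\<dots> \<le> 0.644 * 1.9" using norm_P exp_norm by (intro mult_mono) auto
    finally have "(norm (exp P - 1))\<^sup>2 \<le> (0.644 * 1.9)\<^sup>2" by (intro power_mono) auto
    then have "c\<^sup>2 \<ge> (2 / 5)\<^sup>2" unfolding V norm_G by (simp add: power2_eq_square)
    then have "c \<le> - 2 / 5" using False abs_le_square_iff[of "2 / 5" c] by simp
    \<comment> \<open>This product is 2 c^3 - 3 c - 1, whose nonnegativity is the bound -2/3 on the
      real part of \<open>\<zeta> - \<zeta>^3 / 3\<close>.\<close>
    have "(1 + c) * (2 * c * c - 2 * c - 1) \<ge> 0"
    proof -
      have "2 * (- c) * (- c) \<ge> 2 * (2 / 5) * (2 / 5)"
        using \<open>c \<le> - 2 / 5\<close> by (intro mult_mono) auto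
      then show ?thesis using c \<open>c \<le> - 2 / 5\<close> by (intro mult_nonneg_nonneg) auto
    qed
    then have "2 * c - 4 * c ^ 3 / 3 \<le> - 2 / 3"
      by (simp add: power3_eq_cube algebra_simps)
    then have "Re (exp P) \<le> 1 / 3" using arg_cong[OF V, of Re] Re_G by simp
    moreover have "Re (exp P) \<ge> 1 / 1.9 * (1 - 0.644\<^sup>2 / 2)"
    proof -
      have "1 / 1.9 \<le> exp (- norm P)" using exp_norm by (simp add: exp_minus field_simps)
      also have "\<dots> \<le> exp (Re P)" using abs_Re_le_cmod[of P] by simp
      finally have "1 / 1.9 \<le> exp (Re P)" .
      moreover have "1 - 0.644\<^sup>2 / 2 \<le> cos (Im P)"
      proof -
        have "\<bar>Im P\<bar>\<^sup>2 \<le> 0.644\<^sup>2" using abs_Im_le_cmod[of P] norm_P by (intro power_mono) auto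
        then show ?thesis using cos_ge_taylor2[of "Im P"] by simp
      qed
      ultimately show ?thesis unfolding Re_exp by (intro mult_mono) (auto simp: power2_eq_square)
    qed
    ultimately show False by (simp add: power2_eq_square)
  qed
qed

lemma \<phi>_rat_eq:
  fixes k :: real
  defines "k \<equiv> 1 + sqrt 2"
  assumes "norm \<zeta> \<le> 1"
  shows "(\<phi>_rat \<zeta> - 1) * (of_real k * (of_real k - \<zeta>)) = \<zeta> * (of_real k + \<zeta>)"
    and "\<phi>_rat \<zeta> * (of_real k * (of_real k - \<zeta>)) = (of_real k)\<^sup>2 + \<zeta>\<^sup>2"
proof -
  have "k > 1" by (simp add: k_def)
  then have nz: "of_real k - \<zeta> \<noteq> 0" "complex_of_real k \<noteq> 0"
    using assms(2) by (auto simp del: of_real_add)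
  have eq: "\<phi>_rat \<zeta> = 1 + \<zeta> / of_real k * ((of_real k + \<zeta>) / (of_real k - \<zeta>))"
    by (simp only: \<phi>_rat_def Let_def k_def)
  show *: "(\<phi>_rat \<zeta> - 1) * (of_real k * (of_real k - \<zeta>)) = \<zeta> * (of_real k + \<zeta>)"
    unfolding eq using nz by (simp del: of_real_add)
  then show "\<phi>_rat \<zeta> * (of_real k * (of_real k - \<zeta>)) = (of_real k)\<^sup>2 + \<zeta>\<^sup>2"
    by (simp add: algebra_simps power2_eq_square)
qed

text \<open>The left edge of the strip is the critical one: it excludes every boundary point with k
  Re \<open>\<zeta>\<close> <= k - 2. At the others Re \<open>\<zeta>\<close> > 0, so the target is
  at distance at least 1/k > 0.41 from 1, while the disc bound keeps \<open>exp P\<close> within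
  0.34.\<close>

lemma exp_neq_rat_boundary:
  assumes P: "norm P < 5 / 4 * - ln (2 * sqrt 2 - 2)" "Re P > ln (2 * sqrt 2 - 2)" and \<zeta>: "norm \<zeta> = 1"
  shows "exp P \<noteq> \<phi>_rat \<zeta>"
proof
  assume eq: "exp P = \<phi>_rat \<zeta>"
  define k where "k = 1 + sqrt 2"
  define c s where "c = Re \<zeta>" and "s = Im \<zeta>"
  have s2: "s\<^sup>2 = 1 - c\<^sup>2" using \<zeta> cmod_power2[of \<zeta>] by (simp add: c_def s_def)
  have c2: "c\<^sup>2 \<le> 1" using s2 zero_le_power2[of s] by linarith
  then have c: "- 1 \<le> c" "c \<le> 1" by (auto simp: abs_square_le_1 abs_le_iff)
  have "1.414 \<le> sqrt 2" by (rule real_le_rsqrt) (simp add: power2_eq_square)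
  moreover have "sqrt 2 \<le> 1.415" by (rule real_le_lsqrt) (simp_all add: power2_eq_square)
  ultimately have k: "2.414 \<le> k" "k \<le> 2.415" by (auto simp: k_def)
  \<comment> \<open>This relation reduces powers of \<open>k\<close> throughout; it also makes 2/k
    the value of the target at -1.\<close>
  have k2: "k\<^sup>2 = 2 * k + 1" by (simp add: k_def power2_eq_square algebra_simps)
  have two_k: "2 * sqrt 2 - 2 = 2 / k" using k by (simp add: k_def field_simps)
  have neg_ln: "- ln (2 * sqrt 2 - 2) = ln (k / 2)" unfolding two_k using k by (simp add: ln_div)
  note eqs = \<phi>_rat_eq[of \<zeta>, folded k_def, unfolded eq[symmetric]]
  have norm_k: "(norm (of_real k - \<zeta>))\<^sup>2 = 2 * k * (k - 1 - c)"
  proof -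
    have "(norm (of_real k - \<zeta>))\<^sup>2 = k\<^sup>2 - 2 * k * c + c\<^sup>2 + s\<^sup>2"
      by (simp add: cmod_power2 c_def s_def power2_diff)
    then show ?thesis unfolding s2 by (simp add: k2 power2_eq_square algebra_simps)
       (use k2 in \<open>simp add: power2_eq_square\<close>)
  qed
  have norm_k': "(norm (of_real k + \<zeta>))\<^sup>2 = (norm (of_real k - \<zeta>))\<^sup>2 + 4 * k * c"
    unfolding cmod_power2 by (simp add: c_def power2_eq_square algebra_simps)
  have "(exp (Re P))\<^sup>2 * k\<^sup>2 * (norm (of_real k - \<zeta>))\<^sup>2 = (norm ((of_real k)\<^sup>2 + \<zeta>\<^sup>2))\<^sup>2"
    using \<zeta> k by (simp add: eqs(2)[symmetric] norm_mult power_mult_distrib)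
  also have "\<dots> = (k\<^sup>2 + c\<^sup>2 - s\<^sup>2)\<^sup>2 + 4 * c\<^sup>2 * s\<^sup>2"
    unfolding cmod_power2 by (simp add: c_def s_def power2_eq_square algebra_simps)
  also have "\<dots> = 4 * k\<^sup>2 * (1 + c\<^sup>2)"
    unfolding s2 k2 by (simp add: power2_eq_square algebra_simps) (use k2 in \<open>simp add: power2_eq_square algebra_simps\<close>)
  finally have "k\<^sup>2 * ((exp (Re P))\<^sup>2 * (2 * k * (k - 1 - c))) = k\<^sup>2 * (4 * (1 + c\<^sup>2))"
    unfolding norm_k by (simp add: algebra_simps)
  then have E: "(exp (Re P))\<^sup>2 * (2 * k * (k - 1 - c)) = 4 * (1 + c\<^sup>2)" using k by simp
  have "2 / k = exp (ln (2 / k))" using k by simp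
  also have "\<dots> < exp (Re P)" using P(2) unfolding two_k by (rule exp_less_mono)
  finally have "2 / k < exp (Re P)" .
  then have "(2 / k)\<^sup>2 < (exp (Re P))\<^sup>2" using k by (intro power_strict_mono) auto
  then have "(2 / k)\<^sup>2 * (2 * k * (k - 1 - c)) < 4 * (1 + c\<^sup>2)"
    unfolding E[symmetric] using k c by (intro mult_strict_right_mono) auto
  moreover have "(2 / k)\<^sup>2 * (2 * k * (k - 1 - c)) = 8 * (k - 1 - c) / k"
    using k by (simp add: power2_eq_square)
  ultimately have "8 * (k - 1 - c) < 4 * (1 + c\<^sup>2) * k"
    using k by (simp add: pos_divide_less_eq)
  then have "2 * (k - 1 - c) < k * (1 + c\<^sup>2)" by (simp add: algebra_simps)
  \<comment> \<open>The root c = -1 is the contact point with the edge of the strip.\<close>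
  then have "0 < (c + 1) * (k * c - (k - 2))"
    by (simp add: power2_eq_square algebra_simps)
  then have "k * c > k - 2" using c by (simp add: zero_less_mult_iff)
  then have "k * c > 0" using k by simp
  then have "(norm (of_real k - \<zeta>))\<^sup>2 \<le> (norm (of_real k + \<zeta>))\<^sup>2" unfolding norm_k' by (simp add: mult.assoc)
  then have le: "norm (of_real k - \<zeta>) \<le> norm (of_real k + \<zeta>)" by (rule power2_le_imp_le) simp
  have "norm (exp P - 1) * k * norm (of_real k - \<zeta>) = norm (of_real k + \<zeta>)"
    using arg_cong[OF eqs(1), of norm] \<zeta> k by (simp add: norm_mult)
  then have "1 * norm (of_real k - \<zeta>) \<le> norm (exp P - 1) * k * norm (of_real k - \<zeta>)" using le by simp
  moreover have "norm (of_real k - \<zeta>) > 0" using k \<zeta> by auto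
  ultimately have "1 \<le> norm (exp P - 1) * k" by (simp only: mult_le_cancel_right_pos)
  moreover have "norm (exp P - 1) \<le> 0.34"
  proof -
    have "exp (norm P) ^ 4 < 1.3 ^ 4"
    proof -
      have "exp (norm P) ^ 4 = exp (4 * norm P)" by (simp flip: exp_of_nat_mult)
      also have "\<dots> < exp (5 * ln (k / 2))" using P(1) unfolding neg_ln by simp
      also have "\<dots> = (k / 2) ^ 5" using k by (subst exp_of_nat_mult[of 5, simplified]) simp
      also have "\<dots> \<le> 1.2075 ^ 5" using k by (intro power_mono) auto
      also have "\<dots> \<le> (1.3 :: real) ^ 4" by (simp add: eval_nat_numeral)
      finally show ?thesis .
    qed
    then have exp_norm: "exp (norm P) < 1.3" by (rule power_less_imp_less_base) simp
    have "ln (k / 2) \<le> k / 2 - 1" using k by (intro ln_le_minus_one) auto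
    then have norm_P: "norm P \<le> 0.26" using P(1) k unfolding neg_ln by simp
    have "norm (exp P - 1) \<le> norm P * exp (norm P)" by (rule norm_exp_minus_one_le)
    also have "\<dots> \<le> 0.26 * 1.3" using norm_P exp_norm by (intro mult_mono) auto
    finally show ?thesis by simp
  qed
  then have "norm (exp P - 1) * k \<le> 0.34 * 2.415" using k by (intro mult_mono) auto
  ultimately show False by simp
qed

section \<open>Univalence, analyticity and real values of the targets\<close>

lemma inj_on_\<phi>_Ne: "inj_on \<phi>_Ne (ball 0 1)"
proof (rule inj_onI)
  fix a b assume ab: "a \<in> ball 0 1" "b \<in> ball 0 1" and eq: "\<phi>_Ne a = \<phi>_Ne b"
  \<comment> \<open>Three products of points of the disc cannot sum to 3, so the cofactor of a - b
    does not vanish.\<close>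
  have "(a - b) * (3 - (a\<^sup>2 + a * b + b\<^sup>2)) = 3 * (\<phi>_Ne a - \<phi>_Ne b)"
    by (simp add: \<phi>_Ne_def field_simps power2_eq_square power3_eq_cube)
  then have "a = b \<or> a\<^sup>2 + a * b + b\<^sup>2 = 3" using eq by auto
  moreover have "norm (a\<^sup>2 + a * b + b\<^sup>2) < 3"
  proof -
    have "norm (a\<^sup>2 + a * b + b\<^sup>2) \<le> norm (a\<^sup>2) + norm (a * b) + norm (b\<^sup>2)"
      by (meson add_right_mono norm_triangle_ineq order_trans)
    moreover have "norm (a\<^sup>2) < 1" "norm (b\<^sup>2) < 1" using ab by (simp_all add: norm_power power_less_one_iff)
    moreover have "norm (a * b) \<le> 1" using ab by (simp add: norm_mult mult_le_one)
    ultimately show ?thesis by linarith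
  qed
  ultimately show "a = b" by fastforce
qed

lemma inj_on_\<phi>_sin: "inj_on \<phi>_sin (ball 0 1)"
proof (rule inj_onI)
  fix a b assume ab: "a \<in> ball 0 1" "b \<in> ball 0 1" and "\<phi>_sin a = \<phi>_sin b"
  then have "sin a = sin b" by (simp add: \<phi>_sin_def)
  then obtain n' where "n' \<in> \<int>" and n': "a = b + of_real (2 * n' * pi) \<or> a = - b + of_real ((2 * n' + 1) * pi)"
    unfolding complex_sin_eq by blast
  then obtain n :: int where "n' = of_int n" by (auto elim: Ints_cases)
  with n' have n: "a = b + of_real (2 * of_int n * pi) \<or> a = - b + of_real ((2 * of_int n + 1) * pi)"
    by simp
  \<comment> \<open>Both solution families shift by a multiple of pi; points of the disc permit
    shifts below 2 only, which leaves the zero shift.\<close>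
  have less: "\<bar>t\<bar> < 2" if "a = x + of_real t" "norm x < 1" for x t
  proof -
    have "norm (complex_of_real t) = norm (a - x)" using that(1) by simp
    also have "\<dots> \<le> norm a + norm x" by (rule norm_triangle_ineq4)
    also have "\<dots> < 2" using ab that(2) by simp
    finally show ?thesis by simp
  qed
  have big: "2 \<le> \<bar>of_int m * pi\<bar>" if "m \<noteq> 0" for m :: int
  proof -
    have "1 * 2 \<le> \<bar>real_of_int m\<bar> * pi" using that pi_gt3 by (intro mult_mono) auto
    then show ?thesis by (simp add: abs_mult)
  qed
  from n show "a = b"
  proof
    assume a: "a = b + of_real (2 * of_int n * pi)"
    then have "\<not> 2 \<le> \<bar>of_int (2 * n) * pi\<bar>" using less[OF a] ab by simp
    then have "n = 0" using big[of "2 * n"] by auto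
    then show ?thesis using a by simp
  next
    assume a: "a = - b + of_real ((2 * of_int n + 1) * pi)"
    then have "\<not> 2 \<le> \<bar>of_int (2 * n + 1) * pi\<bar>" using less[OF a] ab by simp
    moreover have "2 * n + 1 \<noteq> 0" by presburger
    ultimately show ?thesis using big by blast
  qed
qed

lemma inj_on_\<phi>_rat: "inj_on \<phi>_rat (ball 0 1)"
proof (rule inj_onI)
  fix a b assume ab: "a \<in> ball 0 1" "b \<in> ball 0 1" and eq: "\<phi>_rat a = \<phi>_rat b"
  define k where "k = complex_of_real (1 + sqrt 2)"
  have k1: "norm k = 1 + sqrt 2" unfolding k_def norm_of_real by simp
  have k2: "k * k = 2 * k + 1"
  proof -
    have "(1 + sqrt 2) * (1 + sqrt 2) = 2 * (1 + sqrt 2) + 1" by (simp add: algebra_simps)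
    from arg_cong[OF this, of complex_of_real] show ?thesis unfolding k_def by simp
  qed
  have "norm k > 0" unfolding k1 by (simp add: add_pos_nonneg)
  then have nz: "k \<noteq> 0" by auto
  define V where "V = \<phi>_rat a - 1"
  have "V * (k * (k - a)) = a * (k + a)" "V * (k * (k - b)) = b * (k + b)"
    using \<phi>_rat_eq(1)[of a] \<phi>_rat_eq(1)[of b] ab eq by (simp_all add: V_def k_def)
  then have "a * (k + a) * (k * (k - b)) = b * (k + b) * (k * (k - a))"
    by (metis mult.assoc mult.commute)
  then have "a * (k + a) * (k - b) = b * (k + b) * (k - a)" using nz by (simp add: mult.assoc)
  then have "(a - b) * (k * k + k * (a + b) - a * b) = 0" by (simp add: algebra_simps)
  moreover have "k * k + k * (a + b) - a * b \<noteq> 0"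
  proof
    assume "k * k + k * (a + b) - a * b = 0"
    then have "k * k = a * b - k * (a + b)" by (simp add: algebra_simps)
    then have "norm k * norm k \<le> norm (a * b) + norm k * norm (a + b)"
      by (metis norm_mult norm_triangle_ineq4)
    \<comment> \<open>The relation k^2 = 2 k + 1 makes this estimate just sufficient; strictness
      comes from \<open>norm (a + b) < 2\<close>.\<close>
    also have "\<dots> < 1 + norm k * 2"
    proof (rule add_le_less_mono)
      show "norm (a * b) \<le> 1" using ab by (simp add: norm_mult mult_le_one)
      have "norm (a + b) < 2" using ab norm_triangle_ineq[of a b] by simp
      then show "norm k * norm (a + b) < norm k * 2" using nz by simp
    qed
    also have "\<dots> = norm k * norm k" unfolding k1 by (simp add: algebra_simps)
    finally show False by simp
  qed
  ultimately show "a = b" by simp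
qed

text \<open>The pole lies at 1 + sqrt 2 > 2, so radius 2 also yields continuity on the closed unit
  disc.\<close>

lemma holomorphic_\<phi>_rat: "\<phi>_rat holomorphic_on ball 0 2"
proof -
  define k where "k = complex_of_real (1 + sqrt 2)"
  have eq: "\<phi>_rat = (\<lambda>z. 1 + z / k * ((k + z) / (k - z)))"
    by (simp add: fun_eq_iff \<phi>_rat_def k_def Let_def)
  have "norm k = 1 + sqrt 2" unfolding k_def norm_of_real by simp
  then have k: "norm k > 2" using real_sqrt_gt_1_iff[of 2] by simp
  then have "k \<noteq> 0" "\<And>z. z \<in> ball 0 2 \<Longrightarrow> k - z \<noteq> 0" by auto
  then show ?thesis unfolding eq by (intro holomorphic_intros) auto
qed

text \<open>The excess over 2/k is (y + 1)^2 divided by a positive number, so the infimum on the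
  real diameter is approached at -1.\<close>

lemma \<phi>_rat_of_real:
  assumes "\<bar>y\<bar> < 1"
  obtains r where "\<phi>_rat (of_real y) = of_real r" "r \<ge> 2 * sqrt 2 - 2"
proof
  define k where "k = 1 + sqrt 2"
  have k: "k > 1" by (simp add: k_def)
  define r where "r = 1 + y / k * ((k + y) / (k - y))"
  show "\<phi>_rat (of_real y) = of_real r"
    by (simp add: \<phi>_rat_def r_def k_def Let_def)
  have ky: "k - y > 0" using assms k by linarith
  have k2: "k * k = 2 * k + 1" by (simp add: k_def algebra_simps)
  have "(2 * sqrt 2 - 2) * k = 2" by (simp add: k_def algebra_simps)
  then have "2 * sqrt 2 - 2 = 2 / k" using k by (simp add: eq_divide_eq)
  moreover have "r - 2 / k = (y + 1)\<^sup>2 / (k * (k - y))"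
  proof -
    have "(r - 2 / k) * (k * (k - y)) = k * k + y * y - 2 * (k - y)"
      using k ky by (simp add: r_def field_simps)
    also have "\<dots> = (y + 1)\<^sup>2" unfolding k2 by (simp add: power2_eq_square algebra_simps)
    finally show ?thesis using k ky by (simp add: eq_divide_eq)
  qed
  moreover have "(y + 1)\<^sup>2 / (k * (k - y)) \<ge> 0" using k ky by simp
  ultimately show "r \<ge> 2 * sqrt 2 - 2" by linarith
qed

section \<open>Sharpness and the three thresholds\<close>

lemma nephroid_subordination_sharp:
  fixes \<sigma> l :: real
  assumes inj: "inj_on \<phi> (ball 0 1)" and cnj: "\<And>z. \<phi> (cnj z) = cnj (\<phi> z)"
    and real: "\<And>y. \<bar>y\<bar> < 1 \<Longrightarrow> \<exists>r. \<phi> (of_real y) = of_real r \<and> \<sigma> * r \<le> \<sigma> * exp (\<sigma> * l)"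
    and \<sigma>: "\<sigma> = 1 \<or> \<sigma> = - 1" and l: "l > 0" and b: "b < (8 / 9) / l"
  shows "\<not> (\<forall>\<beta>\<ge>b. \<forall>p. nephroid_hyp \<beta> p \<longrightarrow> p \<prec>\<^sub>D \<phi>)"
proof
  assume all: "\<forall>\<beta>\<ge>b. \<forall>p. nephroid_hyp \<beta> p \<longrightarrow> p \<prec>\<^sub>D \<phi>"
  \<comment> \<open>\<open>b\<close> may be negative, whereas the extremal function is considered
    for positive \<open>\<beta>\<close>.\<close>
  have "max b 0 < (8 / 9) / l" using l b by simp
  then obtain \<beta> where "max b 0 < \<beta>" and "\<beta> < (8 / 9) / l" using dense by blast
  then have \<beta>: "\<beta> > 0" "\<beta> \<ge> b" "\<beta> < (8 / 9) / l" by auto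
  obtain g where g: "\<And>y. \<bar>y\<bar> < 1 \<Longrightarrow> \<phi> (of_real y) = of_real (g y) \<and> \<sigma> * g y \<le> \<sigma> * exp (\<sigma> * l)"
    using real by metis
  have "l < 8 / 9 / \<beta>" using \<beta> l by (simp add: field_simps)
  then have "\<sigma> * exp (\<sigma> * l) < \<sigma> * exp (\<sigma> * (8 / 9) / \<beta>)" using \<sigma> by auto
  then have "\<not> (\<lambda>z. exp ((z - z ^ 3 / 9) / of_real \<beta>)) \<prec>\<^sub>D \<phi>"
    using \<sigma> \<beta>(1) g by (intro extremal_not_subordinate[where \<sigma> = \<sigma> and g = g, OF inj cnj]) auto
  then show False using all nephroid_hyp_extremal \<beta> by blast
qed

theorem theorem5p2:
  defines "\<beta>a \<equiv> (8 / 9) / ln (1 + sin (1::real))"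
    and "\<beta>b \<equiv> - ((8 / 9) / ln (2 * sqrt 2 - 2 :: real))"
    and "\<beta>c \<equiv> (8 / 9) / ln (5 / 3 :: real)"
  shows
    "(\<forall>\<beta>\<ge>\<beta>a. \<forall>p. nephroid_hyp \<beta> p \<longrightarrow> p \<prec>\<^sub>D \<phi>_sin)
   \<and> (\<forall>\<beta>\<ge>\<beta>b. \<forall>p. nephroid_hyp \<beta> p \<longrightarrow> p \<prec>\<^sub>D \<phi>_rat)
   \<and> (\<forall>\<beta>\<ge>\<beta>c. \<forall>p. nephroid_hyp \<beta> p \<longrightarrow> p \<prec>\<^sub>D \<phi>_Ne)
   \<and> (\<forall>b<\<beta>a. \<not> (\<forall>\<beta>\<ge>b. \<forall>p. nephroid_hyp \<beta> p \<longrightarrow> p \<prec>\<^sub>D \<phi>_sin))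
   \<and> (\<forall>b<\<beta>b. \<not> (\<forall>\<beta>\<ge>b. \<forall>p. nephroid_hyp \<beta> p \<longrightarrow> p \<prec>\<^sub>D \<phi>_rat))
   \<and> (\<forall>b<\<beta>c. \<not> (\<forall>\<beta>\<ge>b. \<forall>p. nephroid_hyp \<beta> p \<longrightarrow> p \<prec>\<^sub>D \<phi>_Ne))"
proof -
  \<comment> \<open>Each threshold becomes (8/9) / l with l > 0. The minus sign in \<open>lb\<close>
    reflects that the value 2 sqrt 2 - 2 at -1 is below 1.\<close>
  define la lb lc where "la = ln (1 + sin (1::real))" and "lb = - ln (2 * sqrt 2 - 2 :: real)"
    and "lc = ln (5 / 3 :: real)"
  have sin1: "sin (1::real) > 0" by (rule sin_gt_zero_02) auto
  have sqrt2: "1 < sqrt 2" "sqrt 2 < 3 / 2"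
    by (simp, rule real_less_lsqrt) (simp_all add: power2_eq_square)
  have pos: "la > 0" "lb > 0" "lc > 0"
    using sin1 sqrt2 by (auto simp: la_def lb_def lc_def)
  have \<beta>: "\<beta>a = (8 / 9) / la" "\<beta>b = (8 / 9) / lb" "\<beta>c = (8 / 9) / lc"
    by (simp_all add: \<beta>a_def \<beta>b_def \<beta>c_def la_def lb_def lc_def)
  have exps: "exp la = 1 + sin 1" "exp (- lb) = 2 * sqrt 2 - 2" "exp lc = 5 / 3"
    using sin1 sqrt2 by (auto simp: la_def lb_def lc_def)
  have hol_sin: "\<phi>_sin holomorphic_on A" and hol_Ne: "\<phi>_Ne holomorphic_on A" for A
    unfolding \<phi>_sin_def \<phi>_Ne_def by (auto intro!: holomorphic_intros)
  have sub: "p \<prec>\<^sub>D \<phi>"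
    if hyp: "nephroid_hyp \<beta> p" "l > 0" "\<beta> \<ge> (8 / 9) / l" and \<phi>: "\<phi> holomorphic_on ball 0 2"
      "inj_on \<phi> (ball 0 1)" "\<phi> 0 = 1"
      and avoid: "\<And>P \<zeta>. norm P < 5 / 4 * l \<Longrightarrow> \<bar>Re P\<bar> < l \<Longrightarrow> norm \<zeta> = 1 \<Longrightarrow> exp P \<noteq> \<phi> \<zeta>"
    for \<beta> p l \<phi>
  proof (rule subordinate_if_avoids_boundary)
    obtain P where P: "\<And>z. z \<in> ball 0 1 \<Longrightarrow> p z = exp (P z)"
      "\<And>z. z \<in> ball 0 1 \<Longrightarrow> \<bar>Re (P z)\<bar> < l" "\<And>z. z \<in> ball 0 1 \<Longrightarrow> norm (P z) < 5 / 4 * l"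
      using nephroid_hyp_logarithm[OF hyp] by metis
    show "p z \<noteq> \<phi> \<zeta>" if "z \<in> ball 0 1" "norm \<zeta> = 1" for z \<zeta>
      unfolding P(1)[OF that(1)] using P(2,3)[OF that(1)] that(2) by (intro avoid)
    show "p holomorphic_on ball 0 1" "p 0 = \<phi> 0"
      using hyp(1) \<phi>(3) by (simp_all add: nephroid_hyp_def)
    show "\<phi> holomorphic_on ball 0 1"
      using \<phi>(1) by (rule holomorphic_on_subset) auto
    show "continuous_on (cball 0 1) \<phi>"
      using \<phi>(1) by (intro holomorphic_on_imp_continuous_on, elim holomorphic_on_subset) auto
  qed (fact \<phi>(2))
  have "p \<prec>\<^sub>D \<phi>_sin" if "\<beta> \<ge> \<beta>a" "nephroid_hyp \<beta> p" for \<beta> p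
  proof (rule sub[OF that(2) pos(1) _ hol_sin inj_on_\<phi>_sin])
    show "exp P \<noteq> \<phi>_sin \<zeta>" if "norm P < 5 / 4 * la" "\<bar>Re P\<bar> < la" "norm \<zeta> = 1" for P \<zeta>
      using that unfolding la_def by (intro exp_neq_sin_boundary) simp_all
  qed (use that(1) in \<open>simp_all add: \<beta> \<phi>_sin_def\<close>)
  moreover have "p \<prec>\<^sub>D \<phi>_rat" if "\<beta> \<ge> \<beta>b" "nephroid_hyp \<beta> p" for \<beta> p
  proof (rule sub[OF that(2) pos(2) _ holomorphic_\<phi>_rat inj_on_\<phi>_rat])
    show "exp P \<noteq> \<phi>_rat \<zeta>" if "norm P < 5 / 4 * lb" "\<bar>Re P\<bar> < lb" "norm \<zeta> = 1" for P \<zeta>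
      using that unfolding lb_def by (intro exp_neq_rat_boundary) simp_all
  qed (use that(1) in \<open>simp_all add: \<beta> \<phi>_rat_def\<close>)
  moreover have "p \<prec>\<^sub>D \<phi>_Ne" if "\<beta> \<ge> \<beta>c" "nephroid_hyp \<beta> p" for \<beta> p
  proof (rule sub[OF that(2) pos(3) _ hol_Ne inj_on_\<phi>_Ne])
    show "exp P \<noteq> \<phi>_Ne \<zeta>" if "norm P < 5 / 4 * lc" "\<bar>Re P\<bar> < lc" "norm \<zeta> = 1" for P \<zeta>
      using that unfolding lc_def by (intro exp_neq_nephroid_boundary) simp_all
  qed (use that(1) in \<open>simp_all add: \<beta> \<phi>_Ne_def\<close>)
  moreover have "\<not> (\<forall>\<beta>\<ge>b. \<forall>p. nephroid_hyp \<beta> p \<longrightarrow> p \<prec>\<^sub>D \<phi>_sin)" if "b < \<beta>a" for b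
  proof (rule nephroid_subordination_sharp[where \<sigma> = 1 and l = la])
    fix y :: real assume "\<bar>y\<bar> < 1"
    then have "sin y \<le> sin 1" using pi_gt3 by (intro sin_monotone_2pi_le) auto
    then show "\<exists>r. \<phi>_sin (of_real y) = of_real r \<and> 1 * r \<le> 1 * exp (1 * la)"
      by (intro exI[of _ "1 + sin y"]) (simp add: \<phi>_sin_def exps sin_of_real)
  qed (use pos that in \<open>auto simp: \<beta> inj_on_\<phi>_sin \<phi>_sin_def cnj_sin\<close>)
  moreover have "\<not> (\<forall>\<beta>\<ge>b. \<forall>p. nephroid_hyp \<beta> p \<longrightarrow> p \<prec>\<^sub>D \<phi>_rat)" if "b < \<beta>b" for b
  proof (rule nephroid_subordination_sharp[where \<sigma> = "- 1" and l = lb])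
    fix y :: real assume "\<bar>y\<bar> < 1"
    then obtain r where "\<phi>_rat (of_real y) = of_real r" "r \<ge> 2 * sqrt 2 - 2"
      by (rule \<phi>_rat_of_real)
    then show "\<exists>r. \<phi>_rat (of_real y) = of_real r \<and> - 1 * r \<le> - 1 * exp (- 1 * lb)"
      by (intro exI[of _ r]) (simp add: exps)
  qed (use pos that in \<open>auto simp: \<beta> inj_on_\<phi>_rat \<phi>_rat_def Let_def\<close>)
  moreover have "\<not> (\<forall>\<beta>\<ge>b. \<forall>p. nephroid_hyp \<beta> p \<longrightarrow> p \<prec>\<^sub>D \<phi>_Ne)" if "b < \<beta>c" for b
  proof (rule nephroid_subordination_sharp[where \<sigma> = 1 and l = lc])
    fix y :: real assume y: "\<bar>y\<bar> < 1"
    \<comment> \<open>The product is three times the gap between 5/3 and the value at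
      \<open>y\<close>.\<close>
    have "(1 - y)\<^sup>2 * (y + 2) \<ge> 0" using y by simp
    then have "1 + y - y ^ 3 / 3 \<le> 5 / 3" by (simp add: power2_eq_square power3_eq_cube field_simps)
    then show "\<exists>r. \<phi>_Ne (of_real y) = of_real r \<and> 1 * r \<le> 1 * exp (1 * lc)"
      by (intro exI[of _ "1 + y - y ^ 3 / 3"]) (simp add: \<phi>_Ne_def exps)
  qed (use pos that in \<open>auto simp: \<beta> inj_on_\<phi>_Ne \<phi>_Ne_def\<close>)
  ultimately show ?thesis by blast
qed

end
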